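(* Every non-trivial S-minimal tetrahedral curve has a linear minimal free resolution. More precisely, if the non-trivial S-minimal curve $C$ is defined by $(a_1,a_2,a_3,a_4,a_5,a_6)$ and $a_6=\max\{a_i\}>0$, then its minimal free resolution has the form \[ 0\to R^{\beta_3}(-a_1-a_6-2)\to R^{\beta_2}(-a_1-a_6-1)\to R^{\beta_1}(-a_1-a_6)\to I_C\to0, \] where \[ \beta_1=(a_1+1)(a_6+1)-\sum_{i=2}^5\frac{a_i(a_i+1)}2,\qquad \beta_2=2a_1a_6+a_1+a_6-\sum_{i=2}^5a_i(a_i+1),\qquad \beta_3=a_1a_6-\sum_{i=2}^5\frac{a_i(a_i+1)}2 . \]
   Context: Let $k$ be a field and $R=k[a,b,c,d]$ with the standard grading. For integers $a_1,\dots,a_6\ge0$, the tetrahedral curve $C$ defined by $(a_1,\dots,a_6)$ is the subscheme of $\mathbb P^3$ with saturated ideal $I_C=(a,b)^{a_1}\cap(a,c)^{a_2}\cap(a,d)^{a_3}\cap(b,c)^{a_4}\cap(b,d)^{a_5}\cap(c,d)^{a_6}$. The trivial curve is $(0,\dots,0)$. S-minimality. For a non-trivial tetrahedral curve consider the systems (A): $a_1+a_2\ge a_4$, $a_1+a_3\ge a_5$, $a_2+a_3\ge a_6$; (B): $a_1+a_4\ge a_2$, $a_1+a_5\ge a_3$, $a_4+a_5\ge a_6$; (C): $a_2+a_4\ge a_1$, $a_2+a_6\ge a_3$, $a_4+a_6\ge a_5$; (D): $a_3+a_5\ge a_1$, $a_3+a_6\ge a_2$, $a_5+a_6\ge a_4$.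 A non-trivial tetrahedral curve is S-minimal if none of the systems (A), (B), (C), (D) holds. Up to permuting the variables $a,b,c,d$ one can always achieve $a_6=\max\{a_i\}$. *)

theory Defs
  imports "HOL-Library.Poly_Mapping" "Jordan_Normal_Form.Matrix"
begin

section \<open>Polynomial rings and their ideals\<close>

text \<open>
  Exponent vectors are finitely supported functions \<open>'v \<Rightarrow>\<^sub>0 nat\<close>; multiplication of
  polynomials is the convolution product of \<^theory>\<open>HOL-Library.Poly_Mapping\<close>.
\<close>

type_synonym ('v, 'k) polynomial = "('v \<Rightarrow>\<^sub>0 nat) \<Rightarrow>\<^sub>0 'k"

definition Var :: "'v \<Rightarrow> ('v, 'k::comm_ring_1) polynomial" where
  "Var v = Poly_Mapping.single (Poly_Mapping.single v 1) 1"

definition monom_degree :: "('v \<Rightarrow>\<^sub>0 nat) \<Rightarrow> nat" where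
  "monom_degree m = (\<Sum>v\<in>Poly_Mapping.keys m. Poly_Mapping.lookup m v)"

text \<open>
  The degree is an integer because degrees of matrix entries arise as differences of
  shifts; the zero polynomial is homogeneous of every degree, and it is the only
  homogeneous polynomial of negative degree.
\<close>

definition homogeneous :: "('v, 'k::comm_ring_1) polynomial \<Rightarrow> int \<Rightarrow> bool" where
  "homogeneous p e \<longleftrightarrow> (\<forall>m\<in>Poly_Mapping.keys p. int (monom_degree m) = e)"

interpretation ring_as_module: Modules.module "(*) :: 'r::comm_ring_1 \<Rightarrow> 'r \<Rightarrow> 'r"
  by unfold_locales (simp_all add: algebra_simps)

definition ideal_gen :: "'r::comm_ring_1 set \<Rightarrow> 'r set" where
  "ideal_gen S = Modules.module.span (*) S"

definition ideal_mult :: "'r::comm_ring_1 set \<Rightarrow> 'r set \<Rightarrow> 'r set" where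
  "ideal_mult I J = ideal_gen {x * y | x y. x \<in> I \<and> y \<in> J}"

primrec ideal_power :: "'r::comm_ring_1 set \<Rightarrow> nat \<Rightarrow> 'r set" where
  "ideal_power I 0 = UNIV"
| "ideal_power I (Suc n) = ideal_mult I (ideal_power I n)"

definition irrelevant_ideal :: "('v, 'k::comm_ring_1) polynomial set" where
  "irrelevant_ideal = ideal_gen (range Var)"


section \<open>Minimal graded free resolutions\<close>

text \<open>
  The graded free module \<open>R(-d\<^sub>1) \<oplus> \<dots> \<oplus> R(-d\<^sub>n)\<close> is encoded by the list
  \<open>[d\<^sub>1, \<dots>, d\<^sub>n]\<close> of the degrees of its basis elements; its elements are the vectors of
  dimension \<open>n\<close> over \<open>R\<close>.  A homomorphism of degree \<open>0\<close> from the module with list \<open>ds\<close>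
  to the one with list \<open>es\<close> is a matrix (acting on column vectors) whose entry in row
  \<open>r\<close> and column \<open>c\<close> is homogeneous of degree \<open>ds ! c - es ! r\<close>.
\<close>

definition graded_hom ::
  "int list \<Rightarrow> int list \<Rightarrow> ('v, 'k::comm_ring_1) polynomial mat \<Rightarrow> bool" where
  "graded_hom ds es A \<longleftrightarrow>
     A \<in> carrier_mat (length es) (length ds) \<and>
     (\<forall>r<length es. \<forall>c<length ds. homogeneous (A $$ (r, c)) (ds ! c - es ! r))"

definition image_mat :: "'r::comm_ring_1 mat \<Rightarrow> 'r vec set" where
  "image_mat A = {A *\<^sub>v v | v. v \<in> carrier_vec (dim_col A)}"

definition kernel_mat :: "'r::comm_ring_1 mat \<Rightarrow> 'r vec set" where
  "kernel_mat A = {v \<in> carrier_vec (dim_col A). A *\<^sub>v v = 0\<^sub>v (dim_row A)}"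

text \<open>
  A complex \<open>\<dots> \<rightarrow> F 2 \<rightarrow> F 1 \<rightarrow> F 0 \<rightarrow> I \<rightarrow> 0\<close> resolving the ideal \<open>I\<close>: \<open>\<phi> 0\<close> is the
  augmentation \<open>F 0 \<rightarrow> I \<subseteq> R\<close>, whose target \<open>R\<close> is the module with list \<open>[0]\<close>, and
  \<open>\<phi> (Suc i)\<close> is the differential \<open>F (Suc i) \<rightarrow> F i\<close>.  A resolution of finite length is one
  where \<open>F i = []\<close>, the zero module, for all large \<open>i\<close>; exactness then makes the last
  nonzero differential injective.
\<close>

definition graded_free_resolution ::
  "('v, 'k::comm_ring_1) polynomial set \<Rightarrow> (nat \<Rightarrow> int list) \<Rightarrow>
     (nat \<Rightarrow> ('v, 'k) polynomial mat) \<Rightarrow> bool" where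
  "graded_free_resolution I F \<phi> \<longleftrightarrow>
     graded_hom (F 0) [0] (\<phi> 0) \<and>
     (\<forall>i. graded_hom (F (Suc i)) (F i) (\<phi> (Suc i))) \<and>
     (\<lambda>v. v $ 0) ` image_mat (\<phi> 0) = I \<and>
     (\<forall>i. image_mat (\<phi> (Suc i)) = kernel_mat (\<phi> i))"

text \<open>
  Minimality: the differential maps \<open>F (Suc i)\<close> into \<open>\<mm> F i\<close>, where \<open>\<mm>\<close> is the irrelevant
  ideal.  No such condition is imposed on the augmentation \<open>\<phi> 0\<close>.
\<close>

definition minimal_graded_free_resolution ::
  "('v, 'k::comm_ring_1) polynomial set \<Rightarrow> (nat \<Rightarrow> int list) \<Rightarrow>
     (nat \<Rightarrow> ('v, 'k) polynomial mat) \<Rightarrow> bool" where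
  "minimal_graded_free_resolution I F \<phi> \<longleftrightarrow>
     graded_free_resolution I F \<phi> \<and>
     (\<forall>i. elements_mat (\<phi> (Suc i)) \<subseteq> irrelevant_ideal)"

definition has_minimal_free_resolution_of_form ::
  "('v, 'k::comm_ring_1) polynomial set \<Rightarrow> int list list \<Rightarrow> bool" where
  "has_minimal_free_resolution_of_form I Fs \<longleftrightarrow>
     (\<exists>\<phi>. minimal_graded_free_resolution I (\<lambda>i. if i < length Fs then Fs ! i else []) \<phi>)"

definition has_linear_minimal_free_resolution ::
  "('v, 'k::comm_ring_1) polynomial set \<Rightarrow> bool" where
  "has_linear_minimal_free_resolution I \<longleftrightarrow>
     (\<exists>F \<phi> d. minimal_graded_free_resolution I F \<phi> \<and> (\<forall>i. \<forall>e\<in>set (F i). e = d + int i))"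


section \<open>Tetrahedral curves\<close>

datatype var = Xa | Xb | Xc | Xd

text \<open>
  A tetrahedral curve is given by \<open>(m 1, \<dots>, m 6)\<close>; the values of \<open>m\<close> outside \<open>{1..6}\<close>
  are irrelevant.
\<close>

definition edge_ideal :: "var \<Rightarrow> var \<Rightarrow> (var, 'k::field) polynomial set" where
  "edge_ideal x y = ideal_gen {Var x, Var y}"

definition tetrahedral_ideal :: "(nat \<Rightarrow> nat) \<Rightarrow> (var, 'k::field) polynomial set" where
  "tetrahedral_ideal m =
     ideal_power (edge_ideal Xa Xb) (m 1) \<inter> ideal_power (edge_ideal Xa Xc) (m 2) \<inter>
     ideal_power (edge_ideal Xa Xd) (m 3) \<inter> ideal_power (edge_ideal Xb Xc) (m 4) \<inter>
     ideal_power (edge_ideal Xb Xd) (m 5) \<inter> ideal_power (edge_ideal Xc Xd) (m 6)"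

definition nontrivial_curve :: "(nat \<Rightarrow> nat) \<Rightarrow> bool" where
  "nontrivial_curve m \<longleftrightarrow> (\<exists>i\<in>{1..6}. m i \<noteq> 0)"

definition system_A :: "(nat \<Rightarrow> nat) \<Rightarrow> bool" where
  "system_A m \<longleftrightarrow> m 1 + m 2 \<ge> m 4 \<and> m 1 + m 3 \<ge> m 5 \<and> m 2 + m 3 \<ge> m 6"

definition system_B :: "(nat \<Rightarrow> nat) \<Rightarrow> bool" where
  "system_B m \<longleftrightarrow> m 1 + m 4 \<ge> m 2 \<and> m 1 + m 5 \<ge> m 3 \<and> m 4 + m 5 \<ge> m 6"

definition system_C :: "(nat \<Rightarrow> nat) \<Rightarrow> bool" where
  "system_C m \<longleftrightarrow> m 2 + m 4 \<ge> m 1 \<and> m 2 + m 6 \<ge> m 3 \<and> m 4 + m 6 \<ge> m 5"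

definition system_D :: "(nat \<Rightarrow> nat) \<Rightarrow> bool" where
  "system_D m \<longleftrightarrow> m 3 + m 5 \<ge> m 1 \<and> m 3 + m 6 \<ge> m 2 \<and> m 5 + m 6 \<ge> m 4"

definition S_minimal :: "(nat \<Rightarrow> nat) \<Rightarrow> bool" where
  "S_minimal m \<longleftrightarrow>
     nontrivial_curve m \<and>
     \<not> system_A m \<and> \<not> system_B m \<and> \<not> system_C m \<and> \<not> system_D m"

end

theory Submission
  imports Defs
begin

text \<open>
  Let \<open>a\<^sub>6\<close> be maximal. S-minimality then says that at each end of the edge \<open>cd\<close> the weights of the
  other two edges sum to less than \<open>a\<^sub>1\<close>, and at each end of \<open>ab\<close> to less than \<open>a\<^sub>6\<close>. Consequently the
  ideal is generated by the monomials \<open>a\<^sup>i b\<^sup>j c\<^sup>k d\<^sup>l\<close> with \<open>i + j = a\<^sub>1\<close> and \<open>k + l = a\<^sub>6\<close> that it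
  contains, and the pairs \<open>(i, k)\<close> form a rectangle of lattice points from which four disjoint
  triangular corners have been cut off. Adding these generators row by row, and each row from its
  overlap with the previous row outwards, every colon ideal is generated by at most two variables.
  The iterated mapping cone over the Koszul complexes of these variables stays linear, and
  \<open>\<beta>\<^sub>1\<close>, \<open>\<beta>\<^sub>2\<close>, \<open>\<beta>\<^sub>3\<close> count the lattice points, unit edges and unit squares of the region.
\<close>

section \<open>Homogeneous parts of polynomials\<close>

text \<open>The order in which the points enter is what keeps every colon ideal linear. An older
  neighbour of a new point contributes the variable by which the two monomials differ, and these
  variables generate the colon ideal as long as every older point lies on the side of one of the
  neighbours. Sweeping a row from its end would break this: a point to the left of all older points,
  entered before the rest of its row, needs both a factor for moving right and one for moving down,
  so its colon ideal starts in degree two or higher. Starting in the overlap avoids this. Growing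
  outwards is then harmless, because a row that sticks out beyond the previous row sticks out beyond
  all earlier ones: it is still leaving a lower corner, and the upper corner on that side has not
  begun. Minimality costs nothing, since linear forms lie in the irrelevant ideal. What has to be
  controlled is the degree of the chain maps in the cone, which exactness alone does not bound;
  taking homogeneous parts repairs this.\<close>

abbreviation keys where "keys \<equiv> Poly_Mapping.keys"
abbreviation lookup where "lookup \<equiv> Poly_Mapping.lookup"
abbreviation single where "single \<equiv> Poly_Mapping.single"

section \<open>Multiplication and division by a monomial\<close>

lemma lookup_single_mult:
  fixes p :: "'a::cancel_comm_monoid_add \<Rightarrow>\<^sub>0 'k::comm_semiring_1"
  shows "lookup (single s 1 * p) (s + m) = lookup p m"
proof -
  have "lookup (single s 1 * p) (s + m) = (\<Sum>l. (\<Sum>q. lookup p q when s + m = l + q) when s = l)"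
    unfolding lookup_mult lookup_single by (simp add: when_mult)
  also have "\<dots> = (\<Sum>q. lookup p q when s + m = s + q)"
    by simp
  also have "\<dots> = lookup p m"
    by simp
  finally show ?thesis .
qed

lemma keys_single_mult:
  fixes p :: "'a::cancel_comm_monoid_add \<Rightarrow>\<^sub>0 'k::comm_semiring_1"
  shows "keys (single s 1 * p) = (+) s ` keys p"
proof
  show "keys (single s 1 * p) \<subseteq> (+) s ` keys p"
    using keys_mult[of "single s 1" p] by auto
  show "(+) s ` keys p \<subseteq> keys (single s 1 * p)"
    by (auto simp: in_keys_iff lookup_single_mult)
qed

lemma single_mult_cancel:
  fixes p q :: "'a::cancel_comm_monoid_add \<Rightarrow>\<^sub>0 'k::comm_semiring_1"
  assumes "single s 1 * p = single s 1 * q"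
  shows "p = q"
  by (rule poly_mapping_eqI) (metis assms lookup_single_mult)

lemma single_dvd:
  fixes p :: "'a::cancel_comm_monoid_add \<Rightarrow>\<^sub>0 'k::comm_semiring_1"
  assumes "\<And>m. m \<in> keys p \<Longrightarrow> \<exists>t. m = s + t"
  obtains q where "p = single s 1 * q"
proof
  have "inj ((+) s)" by simp
  \<comment> \<open>The quotient is \<open>p\<close> reindexed: its coefficient at \<open>t\<close>
    is that of \<open>p\<close> at \<open>s + t\<close>.\<close>
  show "p = single s 1 * Poly_Mapping.map_key ((+) s) p"
  proof (rule poly_mapping_eqI)
    fix m
    show "lookup p m = lookup (single s 1 * Poly_Mapping.map_key ((+) s) p) m"
    proof (cases "\<exists>t. m = s + t")
      case True
      then show ?thesis
        by (auto simp: lookup_single_mult map_key.rep_eq \<open>inj _\<close>)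
    next
      case False
      then have "m \<notin> keys p" "m \<notin> keys (single s 1 * Poly_Mapping.map_key ((+) s) p)"
        using assms by (auto simp: keys_single_mult)
      then show ?thesis by (simp add: in_keys_iff)
    qed
  qed
qed

text \<open>One operator serves two ends: with a degree condition it takes homogeneous components,
  with a divisibility condition it splits off the terms that a monomial divides.\<close>

definition part :: "('a \<Rightarrow> bool) \<Rightarrow> ('a \<Rightarrow>\<^sub>0 'k::zero) \<Rightarrow> 'a \<Rightarrow>\<^sub>0 'k" where
  "part P p = Poly_Mapping.mapp (\<lambda>m c. c when P m) p"

lemma lookup_part: "lookup (part P p) m = (lookup p m when P m)"
  by (auto simp: part_def lookup_mapp when_def in_keys_iff)

lemma keys_part: "keys (part P p) = {m \<in> keys p. P m}"
  by (auto simp: in_keys_iff lookup_part)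

lemma part_add: "part P (p + q) = part P p + part P (q :: 'a \<Rightarrow>\<^sub>0 'k::comm_monoid_add)"
  by (rule poly_mapping_eqI) (simp add: lookup_part lookup_add when_add_distrib)

lemma part_zero [simp]: "part P 0 = 0"
  by (rule poly_mapping_eqI) (simp add: lookup_part)

lemma part_sum: "part P (\<Sum>i\<in>A. f i) = (\<Sum>i\<in>A. part P (f i :: 'a \<Rightarrow>\<^sub>0 'k::comm_monoid_add))"
  by (induction A rule: infinite_finite_induct) (simp_all add: part_add)

lemma part_id: "(\<And>m. m \<in> keys p \<Longrightarrow> P m) \<Longrightarrow> part P p = p"
  by (rule poly_mapping_eqI) (auto simp: lookup_part when_def in_keys_iff)

lemma part_none: "(\<And>m. m \<in> keys p \<Longrightarrow> \<not> P m) \<Longrightarrow> part P p = 0"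
  by (rule poly_mapping_eqI) (auto simp: lookup_part when_def in_keys_iff)

lemma part_split: "part P p + part (\<lambda>m. \<not> P m) p = (p :: 'a \<Rightarrow>\<^sub>0 'k::comm_monoid_add)"
  by (rule poly_mapping_eqI) (auto simp: lookup_part lookup_add when_def)

section \<open>Total degree and homogeneous components\<close>

lemma monom_degree_superset:
  assumes "finite A" "keys m \<subseteq> A"
  shows "monom_degree m = (\<Sum>v\<in>A. lookup m v)"
  unfolding monom_degree_def using assms
  by (intro sum.mono_neutral_left) (auto simp: in_keys_iff)

lemma monom_degree_add: "monom_degree (m + n) = monom_degree m + monom_degree n"
proof -
  have "keys (m + n) \<subseteq> keys m \<union> keys n" by (rule keys_add)
  then show ?thesis
    by (simp add: monom_degree_superset[of "keys m \<union> keys n"] lookup_add sum.distrib)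
qed

lemma monom_degree_single [simp]: "monom_degree (single v n) = n"
  by (simp add: monom_degree_def)

lemma homogeneous_zero [simp]: "homogeneous 0 e"
  by (simp add: homogeneous_def)

lemma homogeneous_single [simp]: "homogeneous (single m c) (int (monom_degree m))"
  by (simp add: homogeneous_def)

lemma homogeneous_Var [simp]: "homogeneous (Var v) 1"
  by (simp add: homogeneous_def Var_def)

lemma homogeneous_uminus [simp]: "homogeneous (- p) e \<longleftrightarrow> homogeneous p e"
  by (simp add: homogeneous_def in_keys_iff)

lemma homogeneous_add: "homogeneous p e \<Longrightarrow> homogeneous q e \<Longrightarrow> homogeneous (p + q) e"
  using keys_add[of p q] by (auto simp: homogeneous_def)

lemma homogeneous_sum: "(\<And>i. i \<in> A \<Longrightarrow> homogeneous (f i) e) \<Longrightarrow> homogeneous (sum f A) e"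
  by (induction A rule: infinite_finite_induct) (simp_all add: homogeneous_add)

lemma homogeneous_mult: "homogeneous p e \<Longrightarrow> homogeneous q f \<Longrightarrow> homogeneous (p * q) (e + f)"
  using keys_mult[of p q] by (fastforce simp: homogeneous_def monom_degree_add)

abbreviation degree_part :: "int \<Rightarrow> ('v, 'k::comm_ring_1) polynomial \<Rightarrow> ('v, 'k) polynomial" where
  "degree_part e \<equiv> part (\<lambda>m. int (monom_degree m) = e)"

lemma homogeneous_degree_part: "homogeneous (degree_part e p) e"
  by (simp add: homogeneous_def keys_part)

text \<open>Multiplying by a form of degree \<open>e\<close> shifts degrees by exactly
  \<open>e\<close>, so the terms of \<open>q\<close> outside degree \<open>f\<close> cannot reach
  degree \<open>e + f\<close>.\<close>

lemma degree_part_mult: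
  assumes "homogeneous p e"
  shows "degree_part (e + f) (p * q) = p * degree_part f q"
proof -
  let ?q = "part (\<lambda>m. \<not> int (monom_degree m) = f) q"
  have "degree_part (e + f) (p * q) = degree_part (e + f) (p * degree_part f q + p * ?q)"
    by (metis distrib_left part_split)
  also have "\<dots> = degree_part (e + f) (p * degree_part f q) + degree_part (e + f) (p * ?q)"
    by (rule part_add)
  also have "degree_part (e + f) (p * degree_part f q) = p * degree_part f q"
    using homogeneous_mult[OF assms homogeneous_degree_part, of f q]
    by (intro part_id) (simp add: homogeneous_def)
  also have "degree_part (e + f) (p * ?q) = 0"
    using keys_mult[of p ?q] assms
    by (intro part_none) (fastforce simp: homogeneous_def keys_part monom_degree_add)
  finally show ?thesis by simp
qed

section \<open>Linear resolutions and mapping cones\<close>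

definition homogeneous_mat :: "int \<Rightarrow> ('v, 'k::comm_ring_1) polynomial mat \<Rightarrow> bool" where
  "homogeneous_mat e A \<longleftrightarrow> (\<forall>i<dim_row A. \<forall>j<dim_col A. homogeneous (A $$ (i, j)) e)"

lemma homogeneous_mat_mult:
  assumes "A \<in> carrier_mat nr n" "B \<in> carrier_mat n nc"
    and "homogeneous_mat e A" "homogeneous_mat f B"
  shows "homogeneous_mat (e + f) (A * B)"
  using assms unfolding homogeneous_mat_def
  by (auto simp: scalar_prod_def intro!: homogeneous_sum homogeneous_mult)

lemma homogeneous_mat_uminus: "homogeneous_mat e A \<Longrightarrow> homogeneous_mat e (- A)"
  by (simp add: homogeneous_mat_def)

lemma homogeneous_mat_zero: "homogeneous_mat e (0\<^sub>m n m)"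
  by (simp add: homogeneous_mat_def)

lemma homogeneous_four_block_mat:
  assumes "A \<in> carrier_mat nr1 nc1" "B \<in> carrier_mat nr1 nc2"
    "C \<in> carrier_mat nr2 nc1" "D \<in> carrier_mat nr2 nc2"
    and "homogeneous_mat e A" "homogeneous_mat e B" "homogeneous_mat e C" "homogeneous_mat e D"
  shows "homogeneous_mat e (four_block_mat A B C D)"
  using assms unfolding homogeneous_mat_def by auto

lemma mult_mat_vec_index:
  assumes "A \<in> carrier_mat nr nc" "v \<in> carrier_vec nc" "i < nr"
  shows "(A *\<^sub>v v) $ i = (\<Sum>j<nc. A $$ (i, j) * v $ j)"
  using assms by (auto simp: scalar_prod_def lessThan_atLeast0)

text \<open>The hypothesis \<open>img\<close> supplies preimages of the columns with no control on
  their degrees; by \<open>degree_part_mult\<close> their components of degree \<open>f\<close>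
  solve the same system.\<close>

lemma homogeneous_lift:
  fixes A W :: "('v, 'k::comm_ring_1) polynomial mat"
  assumes A: "A \<in> carrier_mat nr nc" "homogeneous_mat e A"
    and W: "W \<in> carrier_mat nr k" "homogeneous_mat (e + f) W"
    and img: "\<And>j. j < k \<Longrightarrow> col W j \<in> image_mat A"
  obtains U where "U \<in> carrier_mat nc k" "homogeneous_mat f U" "A * U = W"
proof -
  have "\<forall>j<k. \<exists>u. u \<in> carrier_vec nc \<and> col W j = A *\<^sub>v u"
    using img A(1) by (auto simp: image_mat_def)
  then obtain u where u: "\<And>j. j < k \<Longrightarrow> u j \<in> carrier_vec nc"
    "\<And>j. j < k \<Longrightarrow> col W j = A *\<^sub>v u j"
    by metis
  define U where "U = mat nc k (\<lambda>(i, j). degree_part f (u j $ i))"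
  show thesis
  proof
    show "U \<in> carrier_mat nc k" "homogeneous_mat f U"
      by (simp_all add: U_def homogeneous_mat_def homogeneous_degree_part)
    show "A * U = W"
    proof (rule eq_matI)
      fix i j assume "i < dim_row W" "j < dim_col W"
      then have ij: "i < nr" "j < k" using W(1) by auto
      have eq: "W $$ (i, j) = (\<Sum>l<nc. A $$ (i, l) * u j $ l)"
        using u(2)[OF ij(2)] mult_mat_vec_index[OF A(1) u(1)[OF ij(2)] ij(1)] ij W(1)
        by (metis carrier_matD index_col)
      have "(A * U) $$ (i, j) = (\<Sum>l<nc. A $$ (i, l) * degree_part f (u j $ l))"
        using A ij by (auto simp: U_def scalar_prod_def lessThan_atLeast0)
      also have "\<dots> = degree_part (e + f) (\<Sum>l<nc. A $$ (i, l) * u j $ l)"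
        using A ij unfolding part_sum
        by (intro sum.cong refl degree_part_mult[symmetric]) (auto simp: homogeneous_mat_def)
      also have "\<dots> = W $$ (i, j)"
        unfolding eq[symmetric] using W ij
        by (intro part_id) (auto simp: homogeneous_mat_def homogeneous_def)
      finally show "(A * U) $$ (i, j) = W $$ (i, j)" .
    qed (use A W in \<open>auto simp: U_def\<close>)
  qed
qed

lemma mult_mat_unit_vec:
  fixes A :: "'r::comm_ring_1 mat"
  assumes "A \<in> carrier_mat nr nc" "j < nc"
  shows "A *\<^sub>v unit_vec nc j = col A j"
proof (rule eq_vecI)
  fix i assume "i < dim_vec (col A j)"
  then have "i < nr" using assms by simp
  then show "(A *\<^sub>v unit_vec nc j) $ i = col A j $ i"
    using mult_mat_vec_index[OF assms(1) unit_vec_carrier \<open>i < nr\<close>, of j] assms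
    by (simp add: if_distrib[of "\<lambda>x. _ * x"] cong: if_cong)
qed (use assms in auto)

lemma mult_mat_vec_zero:
  fixes A :: "'r::comm_ring_1 mat"
  assumes "A \<in> carrier_mat nr nc"
  shows "A *\<^sub>v 0\<^sub>v nc = 0\<^sub>v nr"
  using assms by (intro eq_vecI) auto

lemma mult_mat_vec_uminus:
  fixes A :: "'r::comm_ring_1 mat"
  assumes "A \<in> carrier_mat nr nc" "v \<in> carrier_vec nc"
  shows "A *\<^sub>v (- v) = - (A *\<^sub>v v)"
  using assms by (intro eq_vecI) (auto simp: scalar_prod_def sum_negf)

text \<open>Only ranks are recorded, since the degrees of the basis elements are \<open>d\<close>,
  \<open>d + 1\<close>, \<open>d + 2\<close>. Degree 1 of \<open>B\<close> and \<open>C\<close> will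
  give minimality, and the condition on \<open>kernel_mat C\<close> ends the resolution.\<close>

definition linear_resolution ::
  "int \<Rightarrow> ('v, 'k::comm_ring_1) polynomial set \<Rightarrow> nat \<Rightarrow> nat \<Rightarrow> nat \<Rightarrow> bool" where
  "linear_resolution d I b\<^sub>1 b\<^sub>2 b\<^sub>3 \<longleftrightarrow>
    (\<exists>A B C. A \<in> carrier_mat 1 b\<^sub>1 \<and> B \<in> carrier_mat b\<^sub>1 b\<^sub>2 \<and> C \<in> carrier_mat b\<^sub>2 b\<^sub>3 \<and>
      homogeneous_mat d A \<and> homogeneous_mat 1 B \<and> homogeneous_mat 1 C \<and>
      (\<lambda>v. v $ 0) ` image_mat A = I \<and> image_mat B = kernel_mat A \<and>
      image_mat C = kernel_mat B \<and> kernel_mat C = {0\<^sub>v b\<^sub>3})"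

section \<open>The mapping cone over a colon ideal\<close>

lemma carrier_vec_append_cases:
  assumes "v \<in> carrier_vec (n + m)"
  obtains x y where "v = x @\<^sub>v y" "x \<in> carrier_vec n" "y \<in> carrier_vec m"
  by (metis assms vec_first_last_append vec_first_carrier vec_last_carrier)

lemma append_zero_vec: "0\<^sub>v n @\<^sub>v 0\<^sub>v m = 0\<^sub>v (n + m)"
  by (rule eq_vecI) auto

lemma append_vec_eq_zero_iff:
  assumes "x \<in> carrier_vec n" "y \<in> carrier_vec m"
  shows "x @\<^sub>v y = 0\<^sub>v (n + m) \<longleftrightarrow> x = 0\<^sub>v n \<and> y = 0\<^sub>v m"
  using assms unfolding append_zero_vec[symmetric] by (subst append_vec_eq[of _ n]) auto

lemma add_vec_cancel_zero:
  fixes x y z :: "'r::comm_ring_1 vec"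
  assumes "x \<in> carrier_vec n" "y \<in> carrier_vec n" "z \<in> carrier_vec n"
    "x + z = 0\<^sub>v n" "y + z = 0\<^sub>v n"
  shows "x - y = 0\<^sub>v n"
proof (rule eq_vecI)
  fix i assume "i < dim_vec (0\<^sub>v n :: 'r vec)"
  then have "i < n" by simp
  moreover from this have "x $ i + z $ i = 0" "y $ i + z $ i = 0"
    using assms by (metis carrier_vecD index_add_vec(1) index_zero_vec(1))+
  ultimately show "(x - y) $ i = 0\<^sub>v n $ i"
    using assms by (metis add_right_cancel carrier_vecD diff_self index_minus_vec(1) index_zero_vec(1))
qed (use assms in auto)

lemma diff_add_cancel_vec:
  fixes x y :: "'r::comm_ring_1 vec"
  assumes "x \<in> carrier_vec n" "y \<in> carrier_vec n"
  shows "x - y + y = x"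
  using assms by (intro eq_vecI) auto

lemma image_mat_row:
  assumes "A \<in> carrier_mat 1 n"
  shows "(\<lambda>v. v $ 0) ` image_mat A = {(A *\<^sub>v u) $ 0 | u. u \<in> carrier_vec n}"
  unfolding image_mat_def using assms by blast

lemma uminus_in_image_mat:
  fixes A :: "'r::comm_ring_1 mat"
  assumes "p \<in> (\<lambda>v. v $ 0) ` image_mat A" and A: "A \<in> carrier_mat 1 n"
  shows "- p \<in> (\<lambda>v. v $ 0) ` image_mat A"
proof -
  from assms obtain u where u: "u \<in> carrier_vec n" "p = (A *\<^sub>v u) $ 0"
    by (auto simp: image_mat_def)
  have "- p = (A *\<^sub>v (- u)) $ 0"
    using u A by (simp add: mult_mat_vec_uminus[OF A])
  then show ?thesis
    unfolding image_mat_row[OF A] using u(1) uminus_carrier_vec by blast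
qed

text \<open>The lifts of the chain map carry the minus sign, so that the blocks of the cone need
  none and the two contributions cancel.\<close>

lemma mult_mat_vec_add_uminus:
  fixes A B G P :: "'r::comm_ring_1 mat"
  assumes A: "A \<in> carrier_mat n k" and B: "B \<in> carrier_mat k m"
    and G: "G \<in> carrier_mat n l" and P: "P \<in> carrier_mat l m"
    and eq: "A * B = - (G * P)" and w: "w \<in> carrier_vec m"
  shows "A *\<^sub>v (B *\<^sub>v w) + G *\<^sub>v (P *\<^sub>v w) = 0\<^sub>v n"
proof -
  have "A *\<^sub>v (B *\<^sub>v w) = - (G * P) *\<^sub>v w"
    unfolding eq[symmetric] by (rule assoc_mult_mat_vec[OF A B w, symmetric])
  also have "\<dots> = - (G *\<^sub>v (P *\<^sub>v w))"
    using G P w by simp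
  finally have "A *\<^sub>v (B *\<^sub>v w) = - (G *\<^sub>v (P *\<^sub>v w))" .
  moreover have "G *\<^sub>v (P *\<^sub>v w) \<in> carrier_vec n"
    by (rule mult_mat_vec_carrier[OF G mult_mat_vec_carrier[OF P w]])
  ultimately show ?thesis by (simp only: uminus_l_inv_vec)
qed

text \<open>
  If \<open>A, B, C\<close> resolve \<open>R/I\<close> and \<open>P, Q\<close> resolve \<open>R/(I : g)\<close>, then the mapping cone of the chain
  map lifting multiplication by \<open>g\<close> resolves \<open>R/(I + (g))\<close>.
\<close>

lemma mapping_cone:
  fixes A B C P Q U V :: "'r::comm_ring_1 mat" and g :: 'r
  defines "G \<equiv> mat 1 1 (\<lambda>_. g)"
  assumes A: "A \<in> carrier_mat 1 b\<^sub>1" and B: "B \<in> carrier_mat b\<^sub>1 b\<^sub>2" and C: "C \<in> carrier_mat b\<^sub>2 b\<^sub>3"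
    and P: "P \<in> carrier_mat 1 r" and Q: "Q \<in> carrier_mat r c"
    and U: "U \<in> carrier_mat b\<^sub>1 r" and V: "V \<in> carrier_mat b\<^sub>2 c"
    and AI: "(\<lambda>v. v $ 0) ` image_mat A = I" and AB: "image_mat B = kernel_mat A"
    and BC: "image_mat C = kernel_mat B" and C0: "kernel_mat C = {0\<^sub>v b\<^sub>3}"
    and colon: "(\<lambda>v. v $ 0) ` image_mat P = {q. g * q \<in> I}"
    and PQ: "image_mat Q = kernel_mat P" and Q0: "kernel_mat Q = {0\<^sub>v c}"
    and AU: "A * U = - (G * P)" and BV: "B * V = - (U * Q)"
  defines "A' \<equiv> four_block_mat A G (0\<^sub>m 0 b\<^sub>1) (0\<^sub>m 0 1)"
    and "B' \<equiv> four_block_mat B U (0\<^sub>m 1 b\<^sub>2) P"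
    and "C' \<equiv> four_block_mat C V (0\<^sub>m r b\<^sub>3) Q"
  shows "(\<lambda>v. v $ 0) ` image_mat A' = {p + g * q | p q. p \<in> I}" (is ?thesis1)
    and "image_mat B' = kernel_mat A'" (is ?thesis2)
    and "image_mat C' = kernel_mat B'" (is ?thesis3)
    and "kernel_mat C' = {0\<^sub>v (b\<^sub>3 + c)}" (is ?thesis4)
proof -
  have G: "G \<in> carrier_mat 1 1" by (simp add: G_def)
  have Pc: "P *\<^sub>v w \<in> carrier_vec 1" if "w \<in> carrier_vec r" for w
    using P that by auto
  have Gq: "(G *\<^sub>v q) $ 0 = g * q $ 0" if "q \<in> carrier_vec 1" for q
    using mult_mat_vec_index[OF G that, of 0] by (simp add: G_def)
  have minus_in_I: "- p \<in> I" if "p \<in> I" for p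
    using that A unfolding AI[symmetric] by (rule uminus_in_image_mat)
  have F1: "A *\<^sub>v (U *\<^sub>v w) + G *\<^sub>v (P *\<^sub>v w) = 0\<^sub>v 1" if "w \<in> carrier_vec r" for w
    by (rule mult_mat_vec_add_uminus[OF A U G P AU that])
  have PQ0: "P *\<^sub>v (Q *\<^sub>v y) = 0\<^sub>v 1" if "y \<in> carrier_vec c" for y
    using that PQ P Q by (auto simp: image_mat_def kernel_mat_def)
  have F2: "B *\<^sub>v (V *\<^sub>v y) + U *\<^sub>v (Q *\<^sub>v y) = 0\<^sub>v b\<^sub>1" if "y \<in> carrier_vec c" for y
    by (rule mult_mat_vec_add_uminus[OF B V U Q BV that])
  \<comment> \<open>The lower blocks of \<open>A'\<close> have no rows: \<open>A'\<close> is the row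
    \<open>A\<close> extended by the entry \<open>g\<close>.\<close>
  have A': "A' \<in> carrier_mat 1 (b\<^sub>1 + 1)"
    unfolding A'_def using four_block_carrier_mat[OF A, of "0\<^sub>m 0 1" 0 1] by simp
  have B': "B' \<in> carrier_mat (b\<^sub>1 + 1) (b\<^sub>2 + r)"
    unfolding B'_def by (rule four_block_carrier_mat[OF B P])
  have C': "C' \<in> carrier_mat (b\<^sub>2 + r) (b\<^sub>3 + c)"
    unfolding C'_def by (rule four_block_carrier_mat[OF C Q])
  have mA: "A' *\<^sub>v (u @\<^sub>v q) = A *\<^sub>v u + G *\<^sub>v q"
    if "u \<in> carrier_vec b\<^sub>1" "q \<in> carrier_vec 1" for u q
    unfolding A'_def using that A G
    by (subst four_block_mat_mult_vec[OF A G _ _ that]) (auto intro!: eq_vecI)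
  have mB: "B' *\<^sub>v (z @\<^sub>v w) = (B *\<^sub>v z + U *\<^sub>v w) @\<^sub>v P *\<^sub>v w"
    if "z \<in> carrier_vec b\<^sub>2" "w \<in> carrier_vec r" for z w
    unfolding B'_def using that P
    by (subst four_block_mat_mult_vec[OF B U _ P that]) (auto intro!: eq_vecI)
  have mC: "C' *\<^sub>v (t @\<^sub>v y) = (C *\<^sub>v t + V *\<^sub>v y) @\<^sub>v Q *\<^sub>v y"
    if "t \<in> carrier_vec b\<^sub>3" "y \<in> carrier_vec c" for t y
    unfolding C'_def using that Q
    by (subst four_block_mat_mult_vec[OF C V _ Q that]) (auto intro!: eq_vecI)

  show ?thesis1
  proof (intro equalityI subsetI)
    fix p assume "p \<in> (\<lambda>v. v $ 0) ` image_mat A'"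
    then obtain v where v: "v \<in> carrier_vec (b\<^sub>1 + 1)" "p = (A' *\<^sub>v v) $ 0"
      using A' by (auto simp: image_mat_def)
    from v(1) obtain u q where uq: "v = u @\<^sub>v q" "u \<in> carrier_vec b\<^sub>1" "q \<in> carrier_vec 1"
      by (rule carrier_vec_append_cases)
    have "p = (A *\<^sub>v u) $ 0 + g * q $ 0" using v uq mA A G Gq by simp
    moreover have "(A *\<^sub>v u) $ 0 \<in> I"
      unfolding AI[symmetric] image_mat_row[OF A] using uq by blast
    ultimately show "p \<in> {p + g * q | p q. p \<in> I}" by blast
  next
    fix p assume "p \<in> {p + g * q | p q. p \<in> I}"
    then obtain p' q where p: "p = p' + g * q" "p' \<in> I" by blast
    then obtain u where u: "u \<in> carrier_vec b\<^sub>1" "p' = (A *\<^sub>v u) $ 0"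
      using AI A by (auto simp: image_mat_def)
    define q' where "q' = vec 1 (\<lambda>_. q)"
    have q': "q' \<in> carrier_vec 1" "q' $ 0 = q" by (simp_all add: q'_def)
    have "p = (A' *\<^sub>v (u @\<^sub>v q')) $ 0" using u q' p mA A G Gq by simp
    then show "p \<in> (\<lambda>v. v $ 0) ` image_mat A'"
      unfolding image_mat_row[OF A'] using u(1) q'(1) append_carrier_vec by blast
  qed
  show ?thesis2
  proof (intro equalityI subsetI)
    fix v assume "v \<in> image_mat B'"
    then obtain x where "x \<in> carrier_vec (b\<^sub>2 + r)" "v = B' *\<^sub>v x"
      using B' by (auto simp: image_mat_def)
    then obtain z w where zw: "z \<in> carrier_vec b\<^sub>2" "w \<in> carrier_vec r" "v = B' *\<^sub>v (z @\<^sub>v w)"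
      by (metis carrier_vec_append_cases)
    have Bz: "B *\<^sub>v z \<in> carrier_vec b\<^sub>1" "U *\<^sub>v w \<in> carrier_vec b\<^sub>1" using B U zw by auto
    have "A *\<^sub>v (B *\<^sub>v z) = 0\<^sub>v 1"
      using AB A B zw by (auto simp: image_mat_def kernel_mat_def)
    then have "A' *\<^sub>v v = 0\<^sub>v 1"
      using F1[OF zw(2)] A G Pc[OF zw(2)] Bz
      by (simp add: zw mB mA mult_add_distrib_mat_vec[OF A])
    then show "v \<in> kernel_mat A'"
      unfolding kernel_mat_def using A' B' zw by auto
  next
    fix v assume "v \<in> kernel_mat A'"
    then have v: "v \<in> carrier_vec (b\<^sub>1 + 1)" "A' *\<^sub>v v = 0\<^sub>v 1"
      using A' by (auto simp: kernel_mat_def)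
    from v(1) obtain u q where uq: "v = u @\<^sub>v q" "u \<in> carrier_vec b\<^sub>1" "q \<in> carrier_vec 1"
      by (rule carrier_vec_append_cases)
    have eq: "A *\<^sub>v u + G *\<^sub>v q = 0\<^sub>v 1" using v uq mA by simp
    then have "(A *\<^sub>v u + G *\<^sub>v q) $ 0 = 0" by simp
    then have "(A *\<^sub>v u) $ 0 + g * q $ 0 = 0" using A G uq Gq by simp
    then have "g * q $ 0 = - (A *\<^sub>v u) $ 0" by (metis add.inverse_unique)
    moreover have "(A *\<^sub>v u) $ 0 \<in> I"
      unfolding AI[symmetric] image_mat_row[OF A] using uq by blast
    ultimately have "g * q $ 0 \<in> I" using minus_in_I by simp
    \<comment> \<open>The coefficient of \<open>g\<close> in a relation lies in the colon ideal,
      hence comes from some \<open>w\<close> along \<open>P\<close>. Subtracting the cone boundary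
      of \<open>w\<close> leaves a relation among the old generators.\<close>
    then have "q $ 0 \<in> (\<lambda>v. v $ 0) ` image_mat P" using colon by blast
    then obtain w where w: "w \<in> carrier_vec r" "q $ 0 = (P *\<^sub>v w) $ 0"
      using P by (auto simp: image_mat_def)
    have q: "q = P *\<^sub>v w" using uq w P by (intro eq_vecI) auto
    have Uw: "U *\<^sub>v w \<in> carrier_vec b\<^sub>1" using U w by auto
    have "A *\<^sub>v u - A *\<^sub>v (U *\<^sub>v w) = 0\<^sub>v 1"
      using eq F1[OF w(1)] A uq Uw G
      by (intro add_vec_cancel_zero[where z = "G *\<^sub>v q"]) (auto simp: q)
    then have "A *\<^sub>v (u - U *\<^sub>v w) = 0\<^sub>v 1"
      using A uq Uw by (simp add: mult_minus_distrib_mat_vec)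
    then have "u - U *\<^sub>v w \<in> image_mat B"
      using AB A uq Uw by (auto simp: kernel_mat_def)
    then obtain z where z: "z \<in> carrier_vec b\<^sub>2" "u - U *\<^sub>v w = B *\<^sub>v z"
      using B by (auto simp: image_mat_def)
    have "B *\<^sub>v z + U *\<^sub>v w = u"
      unfolding z(2)[symmetric] using uq Uw by (intro diff_add_cancel_vec)
    then have "B' *\<^sub>v (z @\<^sub>v w) = v" using z w uq q mB by simp
    then show "v \<in> image_mat B'"
      unfolding image_mat_def using B' z w by (force intro!: exI[of _ "z @\<^sub>v w"])
  qed
  show ?thesis3
  proof (intro equalityI subsetI)
    fix v assume "v \<in> image_mat C'"
    then obtain x where "x \<in> carrier_vec (b\<^sub>3 + c)" "v = C' *\<^sub>v x"
      using C' by (auto simp: image_mat_def)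
    then obtain t y where ty: "t \<in> carrier_vec b\<^sub>3" "y \<in> carrier_vec c" "v = C' *\<^sub>v (t @\<^sub>v y)"
      by (metis carrier_vec_append_cases)
    have Ct: "C *\<^sub>v t \<in> carrier_vec b\<^sub>2" "V *\<^sub>v y \<in> carrier_vec b\<^sub>2" "Q *\<^sub>v y \<in> carrier_vec r"
      using C V Q ty by auto
    have "B *\<^sub>v (C *\<^sub>v t) = 0\<^sub>v b\<^sub>1"
      using BC B C ty by (auto simp: image_mat_def kernel_mat_def)
    then have "B' *\<^sub>v v = 0\<^sub>v (b\<^sub>1 + 1)"
      using F2[OF ty(2)] PQ0[OF ty(2)] B U Ct
      by (simp add: ty mC mB mult_add_distrib_mat_vec[OF B] append_zero_vec[of b\<^sub>1 1, simplified])
    then show "v \<in> kernel_mat B'"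
      unfolding kernel_mat_def using B' C' ty by auto
  next
    fix v assume "v \<in> kernel_mat B'"
    then have v: "v \<in> carrier_vec (b\<^sub>2 + r)" "B' *\<^sub>v v = 0\<^sub>v (b\<^sub>1 + 1)"
      using B' by (auto simp: kernel_mat_def)
    from v(1) obtain z w where zw: "v = z @\<^sub>v w" "z \<in> carrier_vec b\<^sub>2" "w \<in> carrier_vec r"
      by (rule carrier_vec_append_cases)
    have Uw: "U *\<^sub>v w \<in> carrier_vec b\<^sub>1" "B *\<^sub>v z \<in> carrier_vec b\<^sub>1" using B U zw by auto
    have eq: "B *\<^sub>v z + U *\<^sub>v w = 0\<^sub>v b\<^sub>1" "P *\<^sub>v w = 0\<^sub>v 1"
      using v(2) append_vec_eq_zero_iff[OF _ Pc[OF zw(3)], of "B *\<^sub>v z + U *\<^sub>v w" b\<^sub>1] Uw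
      unfolding zw(1) mB[OF zw(2,3)] by auto
    \<comment> \<open>The second component is a cycle of the complex \<open>P\<close>,
      \<open>Q\<close> and so a boundary; corrected by \<open>V\<close>, the first component becomes
      a cycle of the old resolution.\<close>
    then have "w \<in> image_mat Q" using PQ P zw by (auto simp: kernel_mat_def)
    then obtain y where y: "y \<in> carrier_vec c" "w = Q *\<^sub>v y" using Q by (auto simp: image_mat_def)
    have Vy: "V *\<^sub>v y \<in> carrier_vec b\<^sub>2" using V y by auto
    have "B *\<^sub>v z - B *\<^sub>v (V *\<^sub>v y) = 0\<^sub>v b\<^sub>1"
      using eq(1) F2[OF y(1)] Uw B Vy y
      by (intro add_vec_cancel_zero[where z = "U *\<^sub>v w"]) auto
    then have "B *\<^sub>v (z - V *\<^sub>v y) = 0\<^sub>v b\<^sub>1"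
      using B zw Vy by (simp add: mult_minus_distrib_mat_vec)
    then have "z - V *\<^sub>v y \<in> image_mat C"
      using BC B zw Vy by (auto simp: kernel_mat_def)
    then obtain t where t: "t \<in> carrier_vec b\<^sub>3" "z - V *\<^sub>v y = C *\<^sub>v t"
      using C by (auto simp: image_mat_def)
    have "C *\<^sub>v t + V *\<^sub>v y = z"
      unfolding t(2)[symmetric] using zw Vy by (intro diff_add_cancel_vec)
    then have "C' *\<^sub>v (t @\<^sub>v y) = v" using t y zw mC by simp
    then show "v \<in> image_mat C'"
      unfolding image_mat_def using C' t y by (force intro!: exI[of _ "t @\<^sub>v y"])
  qed
  show ?thesis4
  proof (intro equalityI subsetI)
    fix v assume "v \<in> kernel_mat C'"
    then have v: "v \<in> carrier_vec (b\<^sub>3 + c)" "C' *\<^sub>v v = 0\<^sub>v (b\<^sub>2 + r)"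
      using C' by (auto simp: kernel_mat_def)
    from v(1) obtain t y where ty: "v = t @\<^sub>v y" "t \<in> carrier_vec b\<^sub>3" "y \<in> carrier_vec c"
      by (rule carrier_vec_append_cases)
    have cs: "C *\<^sub>v t + V *\<^sub>v y \<in> carrier_vec b\<^sub>2" "Q *\<^sub>v y \<in> carrier_vec r" using C V Q ty by auto
    have eq: "C *\<^sub>v t + V *\<^sub>v y = 0\<^sub>v b\<^sub>2" "Q *\<^sub>v y = 0\<^sub>v r"
      using v(2) append_vec_eq_zero_iff[OF cs] unfolding ty(1) mC[OF ty(2,3)] by auto
    then have "y \<in> kernel_mat Q" using Q ty by (auto simp: kernel_mat_def)
    then have y: "y = 0\<^sub>v c" using Q0 by simp
    then have "C *\<^sub>v t = 0\<^sub>v b\<^sub>2" using eq(1) V C ty by (auto simp: mult_mat_vec_zero[OF V])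
    then have "t \<in> kernel_mat C" using C ty by (auto simp: kernel_mat_def)
    then have "t = 0\<^sub>v b\<^sub>3" using C0 by simp
    then show "v \<in> {0\<^sub>v (b\<^sub>3 + c)}" using y ty append_zero_vec by simp
  next
    fix v assume "v \<in> {0\<^sub>v (b\<^sub>3 + c) :: 'r vec}"
    then show "v \<in> kernel_mat C'" using C' by (auto simp: kernel_mat_def mult_mat_vec_zero[OF C'])
  qed
qed

text \<open>Linearity survives the cone: \<open>A * U\<close> has degree \<open>d + 1\<close> and
  \<open>B * V\<close> has degree 2, so both lifts can be chosen with linear entries. The ranks grow
  by 1, \<open>r\<close> and \<open>c\<close>, those of the resolution of the quotient by the colon
  ideal.\<close>

lemma linear_resolution_add_generator:
  fixes g :: "('v, 'k::comm_ring_1) polynomial"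
  assumes res: "linear_resolution d I b\<^sub>1 b\<^sub>2 b\<^sub>3" and g: "homogeneous g d"
    and P: "P \<in> carrier_mat 1 r" "homogeneous_mat 1 P"
    and Q: "Q \<in> carrier_mat r c" "homogeneous_mat 1 Q"
    and colon: "(\<lambda>v. v $ 0) ` image_mat P = {q. g * q \<in> I}"
    and PQ: "image_mat Q = kernel_mat P" and Q0: "kernel_mat Q = {0\<^sub>v c}"
  shows "linear_resolution d {p + g * q | p q. p \<in> I} (b\<^sub>1 + 1) (b\<^sub>2 + r) (b\<^sub>3 + c)"
proof -
  from res obtain A B C where A: "A \<in> carrier_mat 1 b\<^sub>1" "homogeneous_mat d A"
    and B: "B \<in> carrier_mat b\<^sub>1 b\<^sub>2" "homogeneous_mat 1 B"
    and C: "C \<in> carrier_mat b\<^sub>2 b\<^sub>3" "homogeneous_mat 1 C"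
    and AI: "(\<lambda>v. v $ 0) ` image_mat A = I" and AB: "image_mat B = kernel_mat A"
    and BC: "image_mat C = kernel_mat B" and C0: "kernel_mat C = {0\<^sub>v b\<^sub>3}"
    unfolding linear_resolution_def by blast
  define G where "G = mat 1 1 (\<lambda>_. g)"
  have G: "G \<in> carrier_mat 1 1" "homogeneous_mat d G"
    using g by (auto simp: G_def homogeneous_mat_def)
  have imA: "v \<in> image_mat A" if "v \<in> carrier_vec 1" "v $ 0 \<in> I" for v
  proof -
    from that(2) obtain x where x: "x \<in> image_mat A" "v $ 0 = x $ 0" using AI by blast
    then have "v = x" using that A by (intro eq_vecI) (auto simp: image_mat_def)
    with x show ?thesis by simp
  qed
  have GP: "- (G * P) \<in> carrier_mat 1 r" "homogeneous_mat (d + 1) (- (G * P))"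
    using homogeneous_mat_mult[OF G(1) P(1) G(2) P(2)] G P
    by (auto intro: homogeneous_mat_uminus)
  have minus_in_I: "- p \<in> I" if "p \<in> I" for p
    using that A(1) unfolding AI[symmetric] by (rule uminus_in_image_mat)
  \<comment> \<open>The entries of \<open>P\<close> lie in the colon ideal, so \<open>g\<close>
    times each of them lies in \<open>I\<close>.\<close>
  have "col (- (G * P)) j \<in> image_mat A" if "j < r" for j
  proof (rule imA)
    have "P $$ (0, j) = (P *\<^sub>v unit_vec r j) $ 0"
      using P that by (simp add: mult_mat_unit_vec[OF P(1)])
    moreover have "P *\<^sub>v unit_vec r j \<in> image_mat P"
      unfolding image_mat_def using P(1) by auto
    ultimately have "P $$ (0, j) \<in> (\<lambda>v. v $ 0) ` image_mat P" by (rule image_eqI)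
    then have "g * P $$ (0, j) \<in> I" unfolding colon by simp
    moreover have "col (- (G * P)) j $ 0 = - (g * P $$ (0, j))"
      using P(1) that by (simp add: scalar_prod_def G_def)
    ultimately show "col (- (G * P)) j $ 0 \<in> I"
      by (simp only: minus_in_I)
    show "col (- (G * P)) j \<in> carrier_vec 1"
      using carrier_matD(1)[OF GP(1)] by (simp only: carrier_vec_def dim_col mem_Collect_eq)
  qed
  then obtain U where U: "U \<in> carrier_mat b\<^sub>1 r" "homogeneous_mat 1 U" "A * U = - (G * P)"
    by (rule homogeneous_lift[OF A GP])
  have PQ0: "P *\<^sub>v (Q *\<^sub>v y) = 0\<^sub>v 1" if "y \<in> carrier_vec c" for y
    using that PQ P(1) Q(1) by (auto simp: image_mat_def kernel_mat_def)
  have UQ: "- (U * Q) \<in> carrier_mat b\<^sub>1 c" "homogeneous_mat (1 + 1) (- (U * Q))"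
    using homogeneous_mat_mult[OF U(1) Q(1) U(2) Q(2)] U Q
    by (auto intro: homogeneous_mat_uminus)
  \<comment> \<open>Since \<open>A * U = - (G * P)\<close> and \<open>P\<close> kills the image of
    \<open>Q\<close>, these columns are cycles and lift along \<open>B\<close>.\<close>
  have "col (- (U * Q)) j \<in> image_mat B" if "j < c" for j
  proof -
    have e: "unit_vec c j \<in> carrier_vec c" by simp
    have "col (- (U * Q)) j = - (U * Q) *\<^sub>v unit_vec c j"
      using mult_mat_unit_vec[OF UQ(1) that] by simp
    also have "\<dots> = - (U *\<^sub>v (Q *\<^sub>v unit_vec c j))"
      using U Q by simp
    finally have col: "col (- (U * Q)) j = - (U *\<^sub>v (Q *\<^sub>v unit_vec c j))" .
    have y: "Q *\<^sub>v unit_vec c j \<in> carrier_vec r" using Q by auto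
    have "A *\<^sub>v (U *\<^sub>v (Q *\<^sub>v unit_vec c j)) + 0\<^sub>v 1 = 0\<^sub>v 1"
      using mult_mat_vec_add_uminus[OF A(1) U(1) G(1) P(1) U(3) y]
      unfolding PQ0[OF e] mult_mat_vec_zero[OF G(1)] .
    moreover have "A *\<^sub>v (U *\<^sub>v (Q *\<^sub>v unit_vec c j)) \<in> carrier_vec 1"
      by (rule mult_mat_vec_carrier[OF A(1) mult_mat_vec_carrier[OF U(1) y]])
    ultimately have "A *\<^sub>v (U *\<^sub>v (Q *\<^sub>v unit_vec c j)) = 0\<^sub>v 1"
      by (simp only: right_zero_vec)
    then have "A *\<^sub>v (- (U *\<^sub>v (Q *\<^sub>v unit_vec c j))) = 0\<^sub>v 1"
      using A U y by (simp add: mult_mat_vec_uminus[OF A(1)])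
    then show ?thesis unfolding AB col kernel_mat_def using A U y by auto
  qed
  then obtain V where V: "V \<in> carrier_mat b\<^sub>2 c" "homogeneous_mat 1 V" "B * V = - (U * Q)"
    by (rule homogeneous_lift[OF B UQ])
  let ?A = "four_block_mat A G (0\<^sub>m 0 b\<^sub>1) (0\<^sub>m 0 1)"
  let ?B = "four_block_mat B U (0\<^sub>m 1 b\<^sub>2) P"
  let ?C = "four_block_mat C V (0\<^sub>m r b\<^sub>3) Q"
  have A': "?A \<in> carrier_mat 1 (b\<^sub>1 + 1)"
    using four_block_carrier_mat[OF A(1), of "0\<^sub>m 0 1" 0 1] by simp
  have B': "?B \<in> carrier_mat (b\<^sub>1 + 1) (b\<^sub>2 + r)"
    by (rule four_block_carrier_mat[OF B(1) P(1)])
  have C': "?C \<in> carrier_mat (b\<^sub>2 + r) (b\<^sub>3 + c)"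
    by (rule four_block_carrier_mat[OF C(1) Q(1)])
  have homs: "homogeneous_mat d ?A" "homogeneous_mat 1 ?B" "homogeneous_mat 1 ?C"
    by (rule homogeneous_four_block_mat[OF A(1) G(1) zero_carrier_mat zero_carrier_mat
          A(2) G(2) homogeneous_mat_zero homogeneous_mat_zero]
        homogeneous_four_block_mat[OF B(1) U(1) zero_carrier_mat P(1) B(2) U(2) homogeneous_mat_zero P(2)]
        homogeneous_four_block_mat[OF C(1) V(1) zero_carrier_mat Q(1) C(2) V(2) homogeneous_mat_zero Q(2)])+
  show ?thesis
    unfolding linear_resolution_def
    using mapping_cone[OF A(1) B(1) C(1) P(1) Q(1) U(1) V(1) AI AB BC C0 colon PQ Q0
        U(3)[unfolded G_def] V(3)] A' B' C' homs
    unfolding G_def by blast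
qed

section \<open>Koszul complexes on at most two variables\<close>

lemma Var_mult_cancel: "Var x * p = Var x * q \<Longrightarrow> p = q"
  unfolding Var_def by (rule single_mult_cancel)

lemma lookup_exponent_single [simp]: "lookup (single x (n::nat)) y = (if x = y then n else 0)"
  by (simp add: lookup_single when_def)

lemma keys_Var_mult: "keys (Var x * p) = (+) (single x 1) ` keys p"
  unfolding Var_def by (rule keys_single_mult)

lemma Var_dvd:
  assumes "\<And>m. m \<in> keys p \<Longrightarrow> 0 < lookup m x"
  obtains q where "p = Var x * q"
proof -
  have "\<exists>t. m = single x 1 + t" if "m \<in> keys p" for m
  proof
    show "m = single x 1 + (m - single x 1)"
      using assms[OF that] by (intro poly_mapping_eqI) (auto simp: lookup_add lookup_minus)
  qed
  then obtain q where "p = single (single x 1) 1 * q"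
    by (rule single_dvd)
  then show thesis using that unfolding Var_def by blast
qed

lemma image_mat_no_cols:
  fixes A :: "'r::comm_ring_1 mat"
  assumes "A \<in> carrier_mat n 0"
  shows "image_mat A = {0\<^sub>v n}"
proof -
  have col: "dim_col A = 0" using assms by simp
  have 0: "A *\<^sub>v v = 0\<^sub>v n" if "v \<in> carrier_vec 0" for v
    using assms that by (intro eq_vecI) (auto simp: scalar_prod_def)
  show ?thesis
    unfolding image_mat_def col
  proof (intro equalityI subsetI)
    fix w assume "w \<in> {0\<^sub>v n :: 'r vec}"
    then have "w = A *\<^sub>v 0\<^sub>v 0" using 0[of "0\<^sub>v 0"] by simp
    then show "w \<in> {A *\<^sub>v v | v. v \<in> carrier_vec 0}" using zero_carrier_vec by blast
  qed (use 0 in blast)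
qed

lemma kernel_mat_no_cols:
  fixes A :: "'r::comm_ring_1 mat"
  assumes "A \<in> carrier_mat n 0"
  shows "kernel_mat A = {0\<^sub>v 0}"
proof -
  have "A *\<^sub>v 0\<^sub>v 0 = 0\<^sub>v n" using mult_mat_vec_zero[OF assms] .
  then show ?thesis using assms by (auto simp: kernel_mat_def)
qed

text \<open>The empty Koszul complex serves to start from the zero ideal.\<close>

lemma linear_resolution_add_generator_0:
  fixes g :: "('v, 'k::comm_ring_1) polynomial"
  assumes res: "linear_resolution d I b\<^sub>1 b\<^sub>2 b\<^sub>3" and g: "homogeneous g d"
    and colon: "{q. g * q \<in> I} = {0}"
  shows "linear_resolution d {p + g * q | p q. p \<in> I} (b\<^sub>1 + 1) b\<^sub>2 b\<^sub>3"
proof -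
  have P: "0\<^sub>m 1 0 \<in> carrier_mat 1 0" and Q: "0\<^sub>m 0 0 \<in> carrier_mat 0 0" by simp_all
  have 1: "(\<lambda>v. v $ 0) ` image_mat (0\<^sub>m 1 0) = {q. g * q \<in> I}"
    unfolding colon image_mat_no_cols[OF P] by simp
  have 2: "image_mat (0\<^sub>m 0 0) = kernel_mat (0\<^sub>m 1 0)"
    unfolding image_mat_no_cols[OF Q] kernel_mat_no_cols[OF P] by simp
  show ?thesis
    using linear_resolution_add_generator[OF res g P homogeneous_mat_zero Q homogeneous_mat_zero
        1 2 kernel_mat_no_cols[OF Q]] by simp
qed

lemma linear_resolution_add_generator_1:
  fixes g :: "('v, 'k::comm_ring_1) polynomial"
  assumes res: "linear_resolution d I b\<^sub>1 b\<^sub>2 b\<^sub>3" and g: "homogeneous g d"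
    and colon: "{q. g * q \<in> I} = {Var x * p | p. True}"
  shows "linear_resolution d {p + g * q | p q. p \<in> I} (b\<^sub>1 + 1) (b\<^sub>2 + 1) b\<^sub>3"
proof -
  define P :: "('v, 'k) polynomial mat" where "P = mat 1 1 (\<lambda>_. Var x)"
  have P: "P \<in> carrier_mat 1 1" "homogeneous_mat 1 P" and Q: "0\<^sub>m 1 0 \<in> carrier_mat 1 0"
    by (simp_all add: P_def homogeneous_mat_def)
  have Pv: "(P *\<^sub>v v) $ 0 = Var x * v $ 0" if "v \<in> carrier_vec 1" for v
    using mult_mat_vec_index[OF P(1) that, of 0] by (simp add: P_def)
  have 1: "(\<lambda>v. v $ 0) ` image_mat P = {q. g * q \<in> I}"
    unfolding colon image_mat_row[OF P(1)]
  proof (intro equalityI subsetI)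
    fix f :: "('v, 'k) polynomial" assume "f \<in> {Var x * p | p. True}"
    then obtain p where "f = Var x * p" by blast
    then have "f = (P *\<^sub>v vec 1 (\<lambda>_. p)) $ 0" using Pv[of "vec 1 (\<lambda>_. p)"] by simp
    then show "f \<in> {(P *\<^sub>v u) $ 0 | u. u \<in> carrier_vec 1}" using vec_carrier by blast
  qed (use Pv in blast)
  have "v = 0\<^sub>v 1" if "v \<in> carrier_vec 1" "P *\<^sub>v v = 0\<^sub>v 1" for v
  proof (rule eq_vecI)
    have "Var x * v $ 0 = Var x * 0" using Pv[OF that(1)] that(2) by simp
    then have "v $ 0 = 0" by (rule Var_mult_cancel)
    then show "v $ i = 0\<^sub>v 1 $ i" if "i < dim_vec (0\<^sub>v 1 :: ('v, 'k) polynomial vec)" for i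
      using that by simp
  qed (use that in simp)
  then have 2: "image_mat (0\<^sub>m 1 0) = kernel_mat P"
    unfolding image_mat_no_cols[OF Q] kernel_mat_def
    using P mult_mat_vec_zero[OF P(1)] by auto
  show ?thesis
    using linear_resolution_add_generator[OF res g P Q homogeneous_mat_zero
        1 2 kernel_mat_no_cols[OF Q]] by simp
qed

text \<open>The matrices are the Koszul complex of two variables. It is exact because they form a
  regular sequence: in any relation \<open>Var y\<close> divides the first coefficient.\<close>

lemma linear_resolution_add_generator_2:
  fixes g :: "('v, 'k::comm_ring_1) polynomial"
  assumes res: "linear_resolution d I b\<^sub>1 b\<^sub>2 b\<^sub>3" and g: "homogeneous g d" and xy: "x \<noteq> y"
    and colon: "{q. g * q \<in> I} = {Var x * p + Var y * q | p q. True}"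
  shows "linear_resolution d {p + g * q | p q. p \<in> I} (b\<^sub>1 + 1) (b\<^sub>2 + 2) (b\<^sub>3 + 1)"
proof -
  define P :: "('v, 'k) polynomial mat" where "P = mat 1 2 (\<lambda>(_, j). if j = 0 then Var x else Var y)"
  define Q :: "('v, 'k) polynomial mat" where "Q = mat 2 1 (\<lambda>(i, _). if i = 0 then Var y else - Var x)"
  have P: "P \<in> carrier_mat 1 2" "homogeneous_mat 1 P" and Q: "Q \<in> carrier_mat 2 1" "homogeneous_mat 1 Q"
    by (auto simp: P_def Q_def homogeneous_mat_def)
  have two: "{..<2::nat} = {0, 1}" by auto
  have Pv: "(P *\<^sub>v v) $ 0 = Var x * v $ 0 + Var y * v $ 1" if "v \<in> carrier_vec 2" for v
    using mult_mat_vec_index[OF P(1) that, of 0] by (simp add: P_def two)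
  have Qv: "(Q *\<^sub>v v) $ 0 = Var y * v $ 0" "(Q *\<^sub>v v) $ 1 = - Var x * v $ 0"
    if "v \<in> carrier_vec 1" for v
    using mult_mat_vec_index[OF Q(1) that, of 0] mult_mat_vec_index[OF Q(1) that, of 1]
    by (simp_all add: Q_def)
  have 1: "(\<lambda>v. v $ 0) ` image_mat P = {q. g * q \<in> I}"
    unfolding colon image_mat_row[OF P(1)]
  proof (intro equalityI subsetI)
    fix f :: "('v, 'k) polynomial" assume "f \<in> {Var x * p + Var y * q | p q. True}"
    then obtain p q where f: "f = Var x * p + Var y * q" by blast
    let ?v = "vec 2 (\<lambda>i. if i = 0 then p else q)"
    have "f = (P *\<^sub>v ?v) $ 0" using Pv[of ?v] f by simp
    then show "f \<in> {(P *\<^sub>v u) $ 0 | u. u \<in> carrier_vec 2}" using vec_carrier by blast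
  qed (use Pv in blast)
  have 2: "image_mat Q = kernel_mat P"
  proof (intro equalityI subsetI)
    fix v assume "v \<in> image_mat Q"
    then obtain u where u: "u \<in> carrier_vec 1" "v = Q *\<^sub>v u"
      using Q by (auto simp: image_mat_def)
    have v: "v \<in> carrier_vec 2" unfolding u(2) using Q(1) u(1) by (rule mult_mat_vec_carrier)
    have "(P *\<^sub>v v) $ 0 = 0"
      unfolding Pv[OF v] unfolding u(2) Qv[OF u(1)] by (simp add: mult.left_commute)
    then have "P *\<^sub>v v = 0\<^sub>v 1" using P by (intro eq_vecI) auto
    then show "v \<in> kernel_mat P" using v P by (simp add: kernel_mat_def)
  next
    fix v assume "v \<in> kernel_mat P"
    then have v: "v \<in> carrier_vec 2" "P *\<^sub>v v = 0\<^sub>v 1" using P by (auto simp: kernel_mat_def)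
    then have "Var x * v $ 0 + Var y * v $ 1 = 0" using Pv[OF v(1)] by simp
    then have eq: "Var x * v $ 0 = Var y * (- v $ 1)" by (simp add: eq_neg_iff_add_eq_0)
    \<comment> \<open>Each term of \<open>v $ 0\<close> times \<open>x\<close> is a term of a
      multiple of \<open>y\<close>; as \<open>x \<noteq> y\<close>, the factor \<open>y\<close> was
      there before.\<close>
    have "0 < lookup m y" if "m \<in> keys (v $ 0)" for m
    proof -
      have "single x 1 + m \<in> keys (Var y * (- v $ 1))"
        unfolding eq[symmetric] keys_Var_mult using that by blast
      then obtain t where "single x 1 + m = single y 1 + t" unfolding keys_Var_mult by blast
      then have "lookup (single x 1 + m) y = lookup (single y 1 + t) y" by simp
      then show ?thesis using xy by (simp add: lookup_add)
    qed
    then obtain q where q: "v $ 0 = Var y * q" by (rule Var_dvd)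
    have "Var y * (Var x * q) = Var y * (- v $ 1)"
      unfolding eq[symmetric] q by (rule mult.left_commute)
    then have "Var x * q = - v $ 1" by (rule Var_mult_cancel)
    then have q1: "v $ 1 = - Var x * q" by simp
    let ?u = "vec 1 (\<lambda>_. q)"
    have "v = Q *\<^sub>v ?u"
    proof (rule eq_vecI)
      fix i assume "i < dim_vec (Q *\<^sub>v ?u)"
      then have "i = 0 \<or> i = 1" using Q by auto
      then show "v $ i = (Q *\<^sub>v ?u) $ i" using Qv[of ?u] q q1 by auto
    qed (use v Q in simp)
    then show "v \<in> image_mat Q" unfolding image_mat_def using Q by auto
  qed
  have "u = 0\<^sub>v 1" if "u \<in> carrier_vec 1" "Q *\<^sub>v u = 0\<^sub>v 2" for u
  proof (rule eq_vecI)
    have "Var y * u $ 0 = Var y * 0" using Qv(1)[OF that(1)] that(2) by simp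
    then have "u $ 0 = 0" by (rule Var_mult_cancel)
    then show "u $ i = 0\<^sub>v 1 $ i" if "i < dim_vec (0\<^sub>v 1 :: ('v, 'k) polynomial vec)" for i
      using that by simp
  qed (use that in simp)
  then have 3: "kernel_mat Q = {0\<^sub>v 1}"
    unfolding kernel_mat_def using Q mult_mat_vec_zero[OF Q(1)] by auto
  show ?thesis
    by (rule linear_resolution_add_generator[OF res g P Q 1 2 3])
qed

section \<open>Monomial ideals described by their supports\<close>

definition monomial_ideal :: "('v \<Rightarrow>\<^sub>0 nat) set \<Rightarrow> ('v, 'k::comm_ring_1) polynomial set" where
  "monomial_ideal S = {p. \<forall>m\<in>keys p. \<exists>s\<in>S. \<exists>t. m = s + t}"

lemma monomial_ideal_empty: "monomial_ideal {} = {0}"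
  by (auto simp: monomial_ideal_def)

text \<open>The terms divisible by \<open>s\<close> form a multiple of the new monomial, and the
  others are divisible by an element of \<open>S\<close>. The right side is the shape in which the
  cone delivers its ideal.\<close>

lemma monomial_ideal_insert:
  "monomial_ideal (insert s S) = {p + single s 1 * q | p q. p \<in> monomial_ideal S}" (is "?L = ?R")
proof (intro equalityI subsetI)
  fix f :: "('a, 'b) polynomial" assume f: "f \<in> ?L"
  let ?D = "\<lambda>m. \<exists>t. m = s + t"
  have "\<exists>t. m = s + t" if "m \<in> keys (part ?D f)" for m
    using that by (simp add: keys_part)
  then obtain q where q: "part ?D f = single s 1 * q" by (rule single_dvd)
  have "part (\<lambda>m. \<not> ?D m) f \<in> monomial_ideal S"
    using f by (auto simp: monomial_ideal_def keys_part)
  moreover have "f = part (\<lambda>m. \<not> ?D m) f + single s 1 * q"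
    unfolding q[symmetric] by (subst add.commute) (rule part_split[symmetric])
  ultimately show "f \<in> ?R" by blast
next
  fix f :: "('a, 'b) polynomial" assume "f \<in> ?R"
  then obtain p q where "f = p + single s 1 * q" "p \<in> monomial_ideal S" by blast
  then show "f \<in> ?L"
    using keys_add[of p "single s 1 * q"] by (force simp: monomial_ideal_def keys_single_mult)
qed

text \<open>Multiplying by a monomial translates the support without cancellation, so colon ideals
  become conditions on single exponents.\<close>

lemma monomial_ideal_colon:
  "single s 1 * q \<in> monomial_ideal S \<longleftrightarrow> (\<forall>m\<in>keys q. \<exists>s'\<in>S. \<exists>t. s + m = s' + t)"
  by (simp add: monomial_ideal_def keys_single_mult)

lemma linear_resolution_zero: "linear_resolution d {0} 0 0 0"
proof -
  have P: "0\<^sub>m 1 0 \<in> carrier_mat 1 0" and Q: "0\<^sub>m 0 0 \<in> carrier_mat 0 0" by simp_all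
  show ?thesis
    unfolding linear_resolution_def
    by (intro exI[of _ "0\<^sub>m 1 0"] exI[of _ "0\<^sub>m 0 0"])
      (simp add: homogeneous_mat_zero image_mat_no_cols[OF P, simplified] image_mat_no_cols[OF Q]
        kernel_mat_no_cols[OF P, simplified] kernel_mat_no_cols[OF Q])
qed

lemma linear_resolution_principal:
  assumes "int (monom_degree s) = d"
  shows "linear_resolution d (monomial_ideal {s} :: ('v, 'k::comm_ring_1) polynomial set) 1 0 0"
proof -
  have "{q. single s 1 * q \<in> {0}} = {0 :: ('v, 'k) polynomial}"
    using single_mult_cancel[of s _ 0] by auto
  from linear_resolution_add_generator_0[OF linear_resolution_zero _ this, of d]
  show ?thesis
    using assms homogeneous_single[of s "1 :: 'k"]
    unfolding monomial_ideal_insert monomial_ideal_empty by simp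
qed

lemma linear_resolution_insert_1:
  assumes res: "linear_resolution d (monomial_ideal S :: ('v, 'k::comm_ring_1) polynomial set) b\<^sub>1 b\<^sub>2 b\<^sub>3"
    and s: "int (monom_degree s) = d"
    and colon: "\<And>m. (\<exists>s'\<in>S. \<exists>t. s + m = s' + t) \<longleftrightarrow> 0 < lookup m x"
  shows "linear_resolution d (monomial_ideal (insert s S) :: ('v, 'k) polynomial set) (b\<^sub>1 + 1) (b\<^sub>2 + 1) b\<^sub>3"
proof -
  have "{q :: ('v, 'k) polynomial. single s 1 * q \<in> monomial_ideal S} = {Var x * p | p. True}" (is "?L = ?R")
  proof (intro equalityI subsetI)
    fix q :: "('v, 'k) polynomial" assume "q \<in> ?L"
    then have "\<And>m. m \<in> keys q \<Longrightarrow> 0 < lookup m x" by (simp add: monomial_ideal_colon colon)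
    then obtain p where "q = Var x * p" by (rule Var_dvd) blast
    then show "q \<in> ?R" by blast
  next
    fix q :: "('v, 'k) polynomial" assume "q \<in> ?R"
    then show "q \<in> ?L" by (auto simp: monomial_ideal_colon colon keys_Var_mult lookup_add)
  qed
  then show ?thesis
    unfolding monomial_ideal_insert
    using homogeneous_single[of s "1 :: 'k"] s by (intro linear_resolution_add_generator_1[OF res]) auto
qed

lemma linear_resolution_insert_2:
  assumes res: "linear_resolution d (monomial_ideal S :: ('v, 'k::comm_ring_1) polynomial set) b\<^sub>1 b\<^sub>2 b\<^sub>3"
    and s: "int (monom_degree s) = d" and xy: "x \<noteq> y"
    and colon: "\<And>m. (\<exists>s'\<in>S. \<exists>t. s + m = s' + t) \<longleftrightarrow> 0 < lookup m x \<or> 0 < lookup m y"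
  shows "linear_resolution d (monomial_ideal (insert s S) :: ('v, 'k) polynomial set) (b\<^sub>1 + 1) (b\<^sub>2 + 2) (b\<^sub>3 + 1)"
proof -
  have "{q :: ('v, 'k) polynomial. single s 1 * q \<in> monomial_ideal S} = {Var x * p + Var y * p' | p p'. True}" (is "?L = ?R")
  proof (intro equalityI subsetI)
    fix q :: "('v, 'k) polynomial" assume q: "q \<in> ?L"
    \<comment> \<open>Terms containing \<open>x\<close> go to the first summand; those left over
      must contain \<open>y\<close>.\<close>
    let ?X = "\<lambda>m. 0 < lookup m x"
    have "\<And>m. m \<in> keys (part ?X q) \<Longrightarrow> 0 < lookup m x" by (simp add: keys_part)
    then obtain p where p: "part ?X q = Var x * p" by (rule Var_dvd) blast
    have "\<And>m. m \<in> keys (part (\<lambda>m. \<not> ?X m) q) \<Longrightarrow> 0 < lookup m y"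
      using q by (auto simp: monomial_ideal_colon colon keys_part)
    then obtain p' where p': "part (\<lambda>m. \<not> ?X m) q = Var y * p'" by (rule Var_dvd) blast
    have "q = Var x * p + Var y * p'" unfolding p[symmetric] p'[symmetric] by (rule part_split[symmetric])
    then show "q \<in> ?R" by blast
  next
    fix q :: "('v, 'k) polynomial" assume "q \<in> ?R"
    then obtain p p' where "q = Var x * p + Var y * p'" by blast
    then have sub: "keys q \<subseteq> keys (Var x * p) \<union> keys (Var y * p')" by (simp add: keys_add)
    have "0 < lookup m x \<or> 0 < lookup m y" if "m \<in> keys q" for m
    proof -
      from that sub have "m \<in> keys (Var x * p) \<union> keys (Var y * p')" ..
      then show ?thesis by (auto simp: keys_Var_mult lookup_add)
    qed
    then show "q \<in> ?L" by (simp add: monomial_ideal_colon colon)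
  qed
  then show ?thesis
    unfolding monomial_ideal_insert
    using homogeneous_single[of s "1 :: 'k"] s xy by (intro linear_resolution_add_generator_2[OF res]) auto
qed

section \<open>Lattice points of a truncated rectangle\<close>

lemma exponent_dvd_iff: "(\<exists>t. m = s + t) \<longleftrightarrow> (\<forall>v. lookup s v \<le> lookup (m :: 'v \<Rightarrow>\<^sub>0 nat) v)"
proof
  assume le: "\<forall>v. lookup s v \<le> lookup m v"
  show "\<exists>t. m = s + t"
  proof
    show "m = s + (m - s)"
      using le by (intro poly_mapping_eqI) (simp add: lookup_add lookup_minus)
  qed
qed (auto simp: lookup_add)

text \<open>The weights \<open>e\<^sub>1\<close>, ..., \<open>e\<^sub>6\<close> sit on the edges
  \<open>wx\<close>, \<open>wy\<close>, \<open>wz\<close>, \<open>xy\<close>, \<open>xz\<close>,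
  \<open>yz\<close>, and the opposite edges \<open>wx\<close>, \<open>yz\<close> dominate. The
  vertices are left unnamed so that any of the three pairs of opposite edges can take this
  role.\<close>

locale tetrahedron =
  fixes w x y z :: 'v and e\<^sub>1 e\<^sub>2 e\<^sub>3 e\<^sub>4 e\<^sub>5 e\<^sub>6 :: nat
  assumes vars_distinct: "distinct [w, x, y, z]" and vars_UNIV: "UNIV = {w, x, y, z}"
    and e24: "e\<^sub>2 + e\<^sub>4 < e\<^sub>1" and e35: "e\<^sub>3 + e\<^sub>5 < e\<^sub>1"
    and e23: "e\<^sub>2 + e\<^sub>3 < e\<^sub>6" and e45: "e\<^sub>4 + e\<^sub>5 < e\<^sub>6"
begin

definition point_monomial :: "nat \<times> nat \<Rightarrow> 'v \<Rightarrow>\<^sub>0 nat" where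
  "point_monomial = (\<lambda>(i, k). single w i + single x (e\<^sub>1 - i) + single y k + single z (e\<^sub>6 - k))"

definition point_ideal :: "(nat \<times> nat) set \<Rightarrow> ('v, 'k::comm_ring_1) polynomial set" where
  "point_ideal T = monomial_ideal (point_monomial ` T)"

abbreviation d :: int where "d \<equiv> int (e\<^sub>1 + e\<^sub>6)"

abbreviation box :: "(nat \<times> nat) set" where "box \<equiv> {..e\<^sub>1} \<times> {..e\<^sub>6}"

lemma lookup_point_monomial:
  "lookup (point_monomial (i, k)) w = i" "lookup (point_monomial (i, k)) x = e\<^sub>1 - i"
  "lookup (point_monomial (i, k)) y = k" "lookup (point_monomial (i, k)) z = e\<^sub>6 - k"
  using vars_distinct by (auto simp: point_monomial_def lookup_add)

lemma all_vars: "(\<forall>v. Q v) \<longleftrightarrow> Q w \<and> Q x \<and> Q y \<and> Q z"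
  using vars_UNIV by (metis UNIV_I insertE singletonD)

lemma degree_point_monomial:
  assumes "(i, k) \<in> box"
  shows "int (monom_degree (point_monomial (i, k))) = d"
  using assms by (simp add: point_monomial_def monom_degree_add)

text \<open>Inside the box no subtraction in \<open>point_monomial\<close> is truncated, so
  divisibility becomes four comparisons of coordinates: reaching a point to the right costs
  \<open>w\<close>, to the left \<open>x\<close>, above \<open>y\<close>, below
  \<open>z\<close>.\<close>

lemma point_colon:
  assumes "T \<subseteq> box" "(i, k) \<in> box"
  shows "(\<exists>s\<in>point_monomial ` T. \<exists>t. point_monomial (i, k) + m = s + t) \<longleftrightarrow>
    (\<exists>(i', k')\<in>T. i' \<le> i + lookup m w \<and> i \<le> i' + lookup m x \<and>
      k' \<le> k + lookup m y \<and> k \<le> k' + lookup m z)"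
proof -
  have "(\<exists>t. point_monomial (i, k) + m = point_monomial (i', k') + t) \<longleftrightarrow>
      i' \<le> i + lookup m w \<and> i \<le> i' + lookup m x \<and> k' \<le> k + lookup m y \<and> k \<le> k' + lookup m z"
    if "(i', k') \<in> T" for i' k'
  proof -
    have "i' \<le> e\<^sub>1" "k' \<le> e\<^sub>6" "i \<le> e\<^sub>1" "k \<le> e\<^sub>6" using assms that by auto
    then show ?thesis
      unfolding exponent_dvd_iff all_vars lookup_add lookup_point_monomial by linarith
  qed
  then show ?thesis by fastforce
qed

lemma add_point_1:
  assumes res: "linear_resolution d (point_ideal T :: ('v, 'k::comm_ring_1) polynomial set) b\<^sub>1 b\<^sub>2 b\<^sub>3"
    and T: "T \<subseteq> box" "(i, k) \<in> box"
    and colon: "\<And>m. (\<exists>(i', k')\<in>T. i' \<le> i + lookup m w \<and> i \<le> i' + lookup m x \<and>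
      k' \<le> k + lookup m y \<and> k \<le> k' + lookup m z) \<longleftrightarrow> 0 < lookup m v"
  shows "linear_resolution d (point_ideal (insert (i, k) T) :: ('v, 'k) polynomial set)
    (b\<^sub>1 + 1) (b\<^sub>2 + 1) b\<^sub>3"
  unfolding point_ideal_def image_insert
  by (rule linear_resolution_insert_1[OF res[unfolded point_ideal_def] degree_point_monomial[OF T(2)]])
    (unfold point_colon[OF T], rule colon)

text \<open>All older points lie below, so each costs a factor \<open>z\<close>, and the one
  directly below costs nothing more. The next two lemmas are the same argument to the left and to
  the right.\<close>

lemma new_row_point:
  assumes res: "linear_resolution d (point_ideal T :: ('v, 'k::comm_ring_1) polynomial set) b\<^sub>1 b\<^sub>2 b\<^sub>3"
    and T: "T \<subseteq> box" "(i, Suc k) \<in> box" "(i, k) \<in> T" and old: "\<And>i' k'. (i', k') \<in> T \<Longrightarrow> k' \<le> k"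
  shows "linear_resolution d (point_ideal (insert (i, Suc k) T) :: ('v, 'k) polynomial set)
    (b\<^sub>1 + 1) (b\<^sub>2 + 1) b\<^sub>3"
  by (rule add_point_1[OF res T(1,2), of z], rule iffI)
    (use old in fastforce, rule bexI[OF _ T(3)], simp)

lemma right_point:
  assumes res: "linear_resolution d (point_ideal T :: ('v, 'k::comm_ring_1) polynomial set) b\<^sub>1 b\<^sub>2 b\<^sub>3"
    and T: "T \<subseteq> box" "(Suc i, k) \<in> box" "(i, k) \<in> T" and old: "\<And>i' k'. (i', k') \<in> T \<Longrightarrow> i' \<le> i"
  shows "linear_resolution d (point_ideal (insert (Suc i, k) T) :: ('v, 'k) polynomial set)
    (b\<^sub>1 + 1) (b\<^sub>2 + 1) b\<^sub>3"
  by (rule add_point_1[OF res T(1,2), of x], rule iffI)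
    (use old in fastforce, rule bexI[OF _ T(3)], simp)

lemma left_point:
  assumes res: "linear_resolution d (point_ideal T :: ('v, 'k::comm_ring_1) polynomial set) b\<^sub>1 b\<^sub>2 b\<^sub>3"
    and T: "T \<subseteq> box" "(i, k) \<in> box" "(Suc i, k) \<in> T" and old: "\<And>i' k'. (i', k') \<in> T \<Longrightarrow> Suc i \<le> i'"
  shows "linear_resolution d (point_ideal (insert (i, k) T) :: ('v, 'k) polynomial set)
    (b\<^sub>1 + 1) (b\<^sub>2 + 1) b\<^sub>3"
  by (rule add_point_1[OF res T(1,2), of w], rule iffI)
    (use old in fastforce, rule bexI[OF _ T(3)], simp)

text \<open>An older point lies below, at the cost of \<open>z\<close>, or further left, at the cost
  of \<open>x\<close>, and the two neighbours cost no more than that. The Koszul relation between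
  \<open>x\<close> and \<open>z\<close> accounts for the unit square completed by the new
  point.\<close>

lemma square_point:
  assumes res: "linear_resolution d (point_ideal T :: ('v, 'k::comm_ring_1) polynomial set) b\<^sub>1 b\<^sub>2 b\<^sub>3"
    and T: "T \<subseteq> box" "(Suc i, Suc k) \<in> box" "(i, Suc k) \<in> T" "(Suc i, k) \<in> T"
    and old: "\<And>i' k'. (i', k') \<in> T \<Longrightarrow> k' \<le> k \<or> i' \<le> i"
  shows "linear_resolution d (point_ideal (insert (Suc i, Suc k) T) :: ('v, 'k) polynomial set)
    (b\<^sub>1 + 1) (b\<^sub>2 + 2) (b\<^sub>3 + 1)"
  unfolding point_ideal_def image_insert
proof (rule linear_resolution_insert_2[OF res[unfolded point_ideal_def] degree_point_monomial[OF T(2)]])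
  show "x \<noteq> z" using vars_distinct by simp
  show "(\<exists>s\<in>point_monomial ` T. \<exists>t. point_monomial (Suc i, Suc k) + m = s + t) \<longleftrightarrow>
      0 < lookup m x \<or> 0 < lookup m z" (is "?L \<longleftrightarrow> ?R") for m
  proof
    assume ?L
    then obtain i' k' where "(i', k') \<in> T" "Suc i \<le> i' + lookup m x" "Suc k \<le> k' + lookup m z"
      unfolding point_colon[OF T(1,2)] by blast
    with old[of i' k'] show ?R by auto
  next
    assume ?R
    then show ?L
      unfolding point_colon[OF T(1,2)]
      by (elim disjE) (rule bexI[OF _ T(3)], simp, rule bexI[OF _ T(4)], simp)
  qed
qed

section \<open>Filling a row from its overlap with the previous one\<close>

lemma right_points:
  assumes "linear_resolution d (point_ideal T :: ('v, 'k::comm_ring_1) polynomial set) b\<^sub>1 b\<^sub>2 b\<^sub>3"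
    and "T \<subseteq> box" "h + n \<le> e\<^sub>1" "k \<le> e\<^sub>6" "(h, k) \<in> T"
    and "0 < n \<Longrightarrow> \<forall>(i', k')\<in>T. i' \<le> h"
  shows "linear_resolution d (point_ideal (T \<union> {h..h + n} \<times> {k}) :: ('v, 'k) polynomial set)
    (b\<^sub>1 + n) (b\<^sub>2 + n) b\<^sub>3"
  using assms
proof (induction n)
  \<comment> \<open>Where nothing is added, older rows may reach beyond \<open>h\<close>; hence the
    guard \<open>0 < n\<close> in the last hypothesis.\<close>
  case 0
  then have "T \<union> {h..h + 0} \<times> {k} = T" by auto
  then show ?case using 0 by simp
next
  case (Suc n)
  have res: "linear_resolution d (point_ideal (insert (Suc (h + n), k) (T \<union> {h..h + n} \<times> {k})) :: ('v, 'k) polynomial set)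
    (b\<^sub>1 + n + 1) (b\<^sub>2 + n + 1) b\<^sub>3"
    using Suc by (intro right_point Suc.IH) fastforce+
  have eq: "T \<union> {h..h + Suc n} \<times> {k} = insert (Suc (h + n), k) (T \<union> {h..h + n} \<times> {k})"
    by auto
  show ?case unfolding eq using res by simp
qed

lemma left_points:
  assumes "linear_resolution d (point_ideal T :: ('v, 'k::comm_ring_1) polynomial set) b\<^sub>1 b\<^sub>2 b\<^sub>3"
    and "T \<subseteq> box" "l + n \<le> e\<^sub>1" "k \<le> e\<^sub>6" "(l + n, k) \<in> T"
    and "0 < n \<Longrightarrow> \<forall>(i', k')\<in>T. l + n \<le> i'"
  shows "linear_resolution d (point_ideal (T \<union> {l..l + n} \<times> {k}) :: ('v, 'k) polynomial set)
    (b\<^sub>1 + n) (b\<^sub>2 + n) b\<^sub>3"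
  using assms
proof (induction n arbitrary: l)
  case 0
  then have "T \<union> {l..l + 0} \<times> {k} = T" by auto
  then show ?case using 0 by simp
next
  case (Suc n)
  \<comment> \<open>Points enter from right to left, so the last one is \<open>l\<close> and the
    induction hypothesis is used at \<open>Suc l\<close>.\<close>
  have "linear_resolution d (point_ideal (T \<union> {Suc l..Suc l + n} \<times> {k}) :: ('v, 'k) polynomial set)
      (b\<^sub>1 + n) (b\<^sub>2 + n) b\<^sub>3"
    using Suc by (intro Suc.IH) simp_all
  then have res: "linear_resolution d (point_ideal (insert (l, k) (T \<union> {Suc l..Suc l + n} \<times> {k})) :: ('v, 'k) polynomial set)
    (b\<^sub>1 + n + 1) (b\<^sub>2 + n + 1) b\<^sub>3"
    using Suc.prems by (intro left_point) fastforce+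
  have eq: "T \<union> {l..l + Suc n} \<times> {k} = insert (l, k) (T \<union> {Suc l..Suc l + n} \<times> {k})"
    by auto
  show ?case unfolding eq using res by simp
qed

text \<open>The first point has only its lower neighbour and adds one edge; each of the
  \<open>n\<close> further points adds two edges and a square.\<close>

lemma square_points:
  assumes "linear_resolution d (point_ideal T :: ('v, 'k::comm_ring_1) polynomial set) b\<^sub>1 b\<^sub>2 b\<^sub>3"
    and "T \<subseteq> box" "l + n \<le> e\<^sub>1" "Suc k \<le> e\<^sub>6" "{l..l + n} \<times> {k} \<subseteq> T"
    and "\<forall>(i', k')\<in>T. k' \<le> k"
  shows "linear_resolution d (point_ideal (T \<union> {l..l + n} \<times> {Suc k}) :: ('v, 'k) polynomial set)
    (b\<^sub>1 + n + 1) (b\<^sub>2 + 2 * n + 1) (b\<^sub>3 + n)"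
  using assms
proof (induction n)
  case 0
  then have res: "linear_resolution d (point_ideal (insert (l, Suc k) T) :: ('v, 'k) polynomial set)
      (b\<^sub>1 + 1) (b\<^sub>2 + 1) b\<^sub>3"
    by (intro new_row_point) auto
  have eq: "T \<union> {l..l + 0} \<times> {Suc k} = insert (l, Suc k) T"
    by auto
  show ?case unfolding eq using res by simp
next
  case (Suc n)
  have sub: "{l..l + n} \<times> {k} \<subseteq> T" using Suc.prems(5) by auto
  have mem: "(Suc (l + n), k) \<in> T" using Suc.prems(5) by auto
  have "linear_resolution d (point_ideal (T \<union> {l..l + n} \<times> {Suc k}) :: ('v, 'k) polynomial set)
      (b\<^sub>1 + n + 1) (b\<^sub>2 + 2 * n + 1) (b\<^sub>3 + n)"
    using Suc.prems sub by (intro Suc.IH) simp_all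
  then have res: "linear_resolution d (point_ideal (insert (Suc (l + n), Suc k) (T \<union> {l..l + n} \<times> {Suc k})) ::
      ('v, 'k) polynomial set) (b\<^sub>1 + n + 1 + 1) (b\<^sub>2 + 2 * n + 1 + 2) (b\<^sub>3 + n + 1)"
    by (rule square_point) (use Suc.prems mem in \<open>auto split: prod.splits\<close>)
  have eq: "T \<union> {l..l + Suc n} \<times> {Suc k} = insert (Suc (l + n), Suc k) (T \<union> {l..l + n} \<times> {Suc k})"
    by auto
  show ?case unfolding eq using res by simp
qed

text \<open>
  The admissible points in row \<open>k\<close> are those between \<open>lo k\<close> and \<open>hi k\<close>, where each truncated
  subtraction is the width of one of the removed corners; the rows \<open>k\<close> and \<open>k + 1\<close> have the points
  between \<open>overlap_lo k\<close> and \<open>overlap_hi k\<close> in common.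
\<close>

definition lo :: "nat \<Rightarrow> nat" where "lo k = (e\<^sub>2 - k) + (e\<^sub>3 - (e\<^sub>6 - k))"
definition hi :: "nat \<Rightarrow> nat" where "hi k = e\<^sub>1 - (e\<^sub>4 - k) - (e\<^sub>5 - (e\<^sub>6 - k))"
definition rows :: "nat \<Rightarrow> (nat \<times> nat) set" where
  "rows n = {(i, k). k \<le> n \<and> lo k \<le> i \<and> i \<le> hi k}"
definition overlap_lo :: "nat \<Rightarrow> nat" where "overlap_lo k = (e\<^sub>2 - k) + (e\<^sub>3 - (e\<^sub>6 - Suc k))"
definition overlap_hi :: "nat \<Rightarrow> nat" where "overlap_hi k = e\<^sub>1 - (e\<^sub>4 - k) - (e\<^sub>5 - (e\<^sub>6 - Suc k))"

text \<open>The four inequalities separate corners that share a side of the rectangle. Diagonally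
  opposite corners stay apart too, since each of the four weights is smaller than both
  \<open>e\<^sub>1\<close> and \<open>e\<^sub>6\<close>.\<close>

lemma lo_le_hi: "k \<le> e\<^sub>6 \<Longrightarrow> lo k \<le> hi k"
  using e24 e35 e23 e45 unfolding lo_def hi_def by linarith

lemma hi_le: "hi k \<le> e\<^sub>1"
  by (simp add: hi_def)

lemma overlap_lo_le_hi: "k < e\<^sub>6 \<Longrightarrow> overlap_lo k \<le> overlap_hi k"
  using e24 e35 e23 e45 unfolding overlap_lo_def overlap_hi_def by linarith

text \<open>On the left the lower corner ends before the upper one begins, by \<open>e23\<close>.
  Hence between adjacent rows at most one of the two widths changes, and \<open>overlap_lo\<close>
  takes the larger value of each.\<close>

lemma overlap_lo_eq: "k < e\<^sub>6 \<Longrightarrow> overlap_lo k = max (lo k) (lo (Suc k))"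
  using e23 unfolding overlap_lo_def lo_def by linarith

lemma overlap_hi_eq:
  assumes "k < e\<^sub>6"
  shows "overlap_hi k = min (hi k) (hi (Suc k))"
proof -
  have "e\<^sub>4 - k = e\<^sub>4 - Suc k \<or> e\<^sub>5 - (e\<^sub>6 - k) = e\<^sub>5 - (e\<^sub>6 - Suc k)"
    using assms e45 by arith
  then show ?thesis
    unfolding overlap_hi_def hi_def by (elim disjE) (auto intro!: min_absorb1[symmetric] min_absorb2[symmetric] diff_le_mono2)
qed

text \<open>If row \<open>Suc k\<close> sticks out on the left, then \<open>k < e\<^sub>2\<close>:
  the lower corner is still shrinking and the upper one has no width yet. Further down, the lower
  corner is only wider.\<close>

lemma lo_decreasing:
  assumes k: "k < e\<^sub>6" "k' \<le> k" and less: "lo (Suc k) < overlap_lo k"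
  shows "overlap_lo k \<le> lo k'"
proof -
  have "e\<^sub>2 - Suc k < e\<^sub>2 - k" using less unfolding overlap_lo_def lo_def by arith
  then have "k < e\<^sub>2" by simp
  then have "e\<^sub>3 - (e\<^sub>6 - Suc k) = 0" using e23 by simp
  then show ?thesis unfolding overlap_lo_def lo_def using k by simp
qed

lemma hi_increasing:
  assumes k: "k < e\<^sub>6" "k' \<le> k" and less: "overlap_hi k < hi (Suc k)"
  shows "hi k' \<le> overlap_hi k"
proof -
  \<comment> \<open>The two bounds differ only in the width of the lower right corner, so that
    corner must still be shrinking.\<close>
  have "k < e\<^sub>4"
  proof (rule ccontr)
    assume "\<not> k < e\<^sub>4"
    then have "overlap_hi k = hi (Suc k)" unfolding overlap_hi_def hi_def by simp
    with less show False by simp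
  qed
  then have "e\<^sub>5 - (e\<^sub>6 - Suc k) = 0" using e45 by simp
  then have "overlap_hi k = e\<^sub>1 - (e\<^sub>4 - k)" unfolding overlap_hi_def by simp
  moreover have "hi k' \<le> e\<^sub>1 - (e\<^sub>4 - k')" by (simp add: hi_def)
  ultimately show ?thesis using k by simp
qed

lemma rows_box: "n \<le> e\<^sub>6 \<Longrightarrow> rows n \<subseteq> box"
  using hi_le by (auto simp: rows_def intro: order_trans)

lemma first_row:
  "linear_resolution d (point_ideal (rows 0) :: ('v, 'k::comm_ring_1) polynomial set)
    (hi 0 - lo 0 + 1) (hi 0 - lo 0) 0"
proof -
  have lh: "lo 0 \<le> hi 0" using lo_le_hi by simp
  have "(lo 0, 0) \<in> box" using lh hi_le[of 0] by simp
  from linear_resolution_principal[OF degree_point_monomial[OF this]]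
  have "linear_resolution d (point_ideal {(lo 0, 0)} :: ('v, 'k) polynomial set) 1 0 0"
    by (simp add: point_ideal_def)
  then have "linear_resolution d (point_ideal ({(lo 0, 0)} \<union> {lo 0..lo 0 + (hi 0 - lo 0)} \<times> {0}) :: ('v, 'k) polynomial set)
      (1 + (hi 0 - lo 0)) (0 + (hi 0 - lo 0)) 0"
    by (rule right_points) (use lh hi_le[of 0] in auto)
  moreover have "{(lo 0, 0)} \<union> {lo 0..lo 0 + (hi 0 - lo 0)} \<times> {0} = rows 0"
    using lh by (auto simp: rows_def)
  ultimately show ?thesis by (simp add: add.commute)
qed

text \<open>Besides \<open>b\<^sub>2\<close>, the second rank counts the horizontal edges of the new
  row and one vertical edge for each point shared with the previous row; the squares lie between
  consecutive shared points.\<close>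

lemma next_row:
  assumes res: "linear_resolution d (point_ideal (rows k) :: ('v, 'k::comm_ring_1) polynomial set) b\<^sub>1 b\<^sub>2 b\<^sub>3"
    and k: "k < e\<^sub>6"
  shows "linear_resolution d (point_ideal (rows (Suc k)) :: ('v, 'k) polynomial set)
    (b\<^sub>1 + (hi (Suc k) - lo (Suc k) + 1))
    (b\<^sub>2 + (hi (Suc k) - lo (Suc k)) + (overlap_hi k - overlap_lo k + 1)) (b\<^sub>3 + (overlap_hi k - overlap_lo k))"
proof -
  let ?l = "overlap_lo k" and ?h = "overlap_hi k"
  define T where "T = rows k \<union> {?l..?h} \<times> {Suc k}"
  define T' where "T' = T \<union> {?h..hi (Suc k)} \<times> {Suc k}"
  note le = overlap_lo_le_hi[OF k] overlap_lo_eq[OF k] overlap_hi_eq[OF k] hi_le[of k] hi_le[of "Suc k"]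
  have le': "lo k \<le> ?l" "lo (Suc k) \<le> ?l" "?l \<le> ?h" "?h \<le> hi k" "?h \<le> hi (Suc k)"
    "hi (Suc k) \<le> e\<^sub>1"
    using le by auto
  have box: "rows k \<subseteq> box" using rows_box k by simp
  have "linear_resolution d (point_ideal (rows k \<union> {?l..?l + (?h - ?l)} \<times> {Suc k}) :: ('v, 'k) polynomial set)
      (b\<^sub>1 + (?h - ?l) + 1) (b\<^sub>2 + 2 * (?h - ?l) + 1) (b\<^sub>3 + (?h - ?l))"
    by (rule square_points[OF res box]) (use k le' in \<open>auto simp: rows_def\<close>)
  then have 1: "linear_resolution d (point_ideal T :: ('v, 'k) polynomial set)
      (b\<^sub>1 + (?h - ?l) + 1) (b\<^sub>2 + 2 * (?h - ?l) + 1) (b\<^sub>3 + (?h - ?l))"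
    using le' by (simp add: T_def)
  have Tbox: "T \<subseteq> box" using box k le' by (auto simp: T_def)
  have "linear_resolution d (point_ideal (T \<union> {?h..?h + (hi (Suc k) - ?h)} \<times> {Suc k}) :: ('v, 'k) polynomial set)
      (b\<^sub>1 + (?h - ?l) + 1 + (hi (Suc k) - ?h)) (b\<^sub>2 + 2 * (?h - ?l) + 1 + (hi (Suc k) - ?h)) (b\<^sub>3 + (?h - ?l))"
  proof (rule right_points[OF 1 Tbox])
    \<comment> \<open>The extension has to pass every earlier row, not only row \<open>k\<close>;
      this is where the shape of the region enters.\<close>
    show "\<forall>(i', k')\<in>T. i' \<le> ?h" if "0 < hi (Suc k) - ?h"
      using hi_increasing[OF k _ that[unfolded zero_less_diff]] by (fastforce simp: T_def rows_def)
  qed (use k le' in \<open>auto simp: T_def\<close>)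
  then have 2: "linear_resolution d (point_ideal T' :: ('v, 'k) polynomial set)
      (b\<^sub>1 + (?h - ?l) + 1 + (hi (Suc k) - ?h)) (b\<^sub>2 + 2 * (?h - ?l) + 1 + (hi (Suc k) - ?h)) (b\<^sub>3 + (?h - ?l))"
    using le' by (simp add: T'_def)
  have T'box: "T' \<subseteq> box" using Tbox k le' by (auto simp: T'_def)
  have 3: "linear_resolution d (point_ideal (T' \<union> {lo (Suc k)..lo (Suc k) + (?l - lo (Suc k))} \<times> {Suc k}) :: ('v, 'k) polynomial set)
      (b\<^sub>1 + (?h - ?l) + 1 + (hi (Suc k) - ?h) + (?l - lo (Suc k)))
      (b\<^sub>2 + 2 * (?h - ?l) + 1 + (hi (Suc k) - ?h) + (?l - lo (Suc k))) (b\<^sub>3 + (?h - ?l))"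
  proof (rule left_points[OF 2 T'box])
    show "\<forall>(i', k')\<in>T'. lo (Suc k) + (?l - lo (Suc k)) \<le> i'" if "0 < ?l - lo (Suc k)"
      using lo_decreasing[OF k _ that[unfolded zero_less_diff]] le' by (fastforce simp: T'_def T_def rows_def)
  qed (use k le' in \<open>auto simp: T'_def T_def\<close>)
  have "T' \<union> {lo (Suc k)..lo (Suc k) + (?l - lo (Suc k))} \<times> {Suc k} = rows (Suc k)"
    using le' by (auto simp: T'_def T_def rows_def le_Suc_eq)
  moreover have "b\<^sub>1 + (?h - ?l) + 1 + (hi (Suc k) - ?h) + (?l - lo (Suc k)) = b\<^sub>1 + (hi (Suc k) - lo (Suc k) + 1)"
    using le' by simp
  moreover have "b\<^sub>2 + 2 * (?h - ?l) + 1 + (hi (Suc k) - ?h) + (?l - lo (Suc k)) =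
      b\<^sub>2 + (hi (Suc k) - lo (Suc k)) + (?h - ?l + 1)"
    using le' by simp
  ultimately show ?thesis using 3 by (simp only:)
qed

lemma linear_resolution_rows:
  "n \<le> e\<^sub>6 \<Longrightarrow> linear_resolution d (point_ideal (rows n) :: ('v, 'k::comm_ring_1) polynomial set)
    (\<Sum>k\<le>n. hi k - lo k + 1)
    ((\<Sum>k\<le>n. hi k - lo k) + (\<Sum>k<n. overlap_hi k - overlap_lo k + 1)) (\<Sum>k<n. overlap_hi k - overlap_lo k)"
proof (induction n)
  case 0
  then show ?case using first_row by simp
next
  case (Suc n)
  then show ?case
    using next_row[of n, OF Suc.IH] by (simp add: algebra_simps)
qed

end

section \<open>Triangular numbers counting the removed corners\<close>

lemma sum_triangle:
  "e \<le> n \<Longrightarrow> (\<Sum>k<n. real (e - k)) = real e * (real e + 1) / 2"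
proof (induction n arbitrary: e)
  case (Suc n)
  \<comment> \<open>Splitting off the term \<open>k = 0\<close> lowers \<open>e\<close> and
    \<open>n\<close> together.\<close>
  then show ?case
    by (cases e) (simp_all del: sum.lessThan_Suc add: sum.lessThan_Suc_shift field_simps)
qed simp

lemma sum_triangle_rev:
  "e \<le> n \<Longrightarrow> (\<Sum>k<n. real (e - (n - Suc k))) = real e * (real e + 1) / 2"
  using sum_triangle sum.nat_diff_reindex[of "\<lambda>k. real (e - k)" n] by simp

text \<open>The one extra term is \<open>e - n\<close>, which is zero. Hence full rows and overlaps
  lose the same total to the corners.\<close>

lemma sum_triangle_atMost:
  "e \<le> n \<Longrightarrow> (\<Sum>k\<le>n. real (e - k)) = real e * (real e + 1) / 2"
  "e \<le> n \<Longrightarrow> (\<Sum>k\<le>n. real (e - (n - k))) = real e * (real e + 1) / 2"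
  using sum_triangle[of e "Suc n"] sum_triangle_rev[of e "Suc n"]
  by (simp_all add: lessThan_Suc_atMost del: sum.lessThan_Suc)

context tetrahedron
begin

section \<open>The lattice region generates the ideal of the curve\<close>

definition admissible :: "nat \<Rightarrow> nat \<Rightarrow> nat \<Rightarrow> nat \<Rightarrow> bool" where
  "admissible i j k l \<longleftrightarrow> e\<^sub>1 \<le> i + j \<and> e\<^sub>2 \<le> i + k \<and> e\<^sub>3 \<le> i + l \<and>
    e\<^sub>4 \<le> j + k \<and> e\<^sub>5 \<le> j + l \<and> e\<^sub>6 \<le> k + l"

text \<open>
  An exponent that is too large in degree can be lowered in one of the two variables, because the
  inequalities blocking both of them would contradict S-minimality.
\<close>

lemma admissible_descent:
  "admissible i j k l \<Longrightarrow> \<exists>i'\<le>i. \<exists>j'\<le>j. \<exists>k'\<le>k. \<exists>l'\<le>l.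
    admissible i' j' k' l' \<and> i' + j' = e\<^sub>1 \<and> k' + l' = e\<^sub>6"
proof (induction "i + j + k + l" arbitrary: i j k l rule: less_induct)
  case less
  have step: ?case
    if "admissible i' j' k' l'" "i' + j' + k' + l' < i + j + k + l" "i' \<le> i" "j' \<le> j" "k' \<le> k" "l' \<le> l"
    for i' j' k' l'
  proof -
    from less.hyps[OF that(2,1)] obtain f g h n where "f \<le> i'" "g \<le> j'" "h \<le> k'" "n \<le> l'"
      and *: "admissible f g h n" "f + g = e\<^sub>1" "h + n = e\<^sub>6" by blast
    with that(3-6) have "f \<le> i" "g \<le> j" "h \<le> k" "n \<le> l" by linarith+
    with * show ?thesis by blast
  qed
  note adm = less.prems[unfolded admissible_def]
  consider "i + j = e\<^sub>1" "k + l = e\<^sub>6" | "e\<^sub>1 < i + j" | "e\<^sub>6 < k + l"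
    using adm by linarith
  then show ?case
  proof cases
    case 1
    then show ?thesis using less.prems by blast
  next
    case 2
    \<comment> \<open>Suppose tight edges block both variables. If they meet, as in
      \<open>i + k = e\<^sub>2\<close> and \<open>j + k = e\<^sub>4\<close>, then
      \<open>i + j \<le> e\<^sub>2 + e\<^sub>4 < e\<^sub>1\<close>. If they are opposite,
      \<open>i + j + k + l\<close> is \<open>e\<^sub>2 + e\<^sub>5\<close> or
      \<open>e\<^sub>3 + e\<^sub>4\<close>, below \<open>e\<^sub>1 + e\<^sub>6\<close>. If one
      exponent is zero, the other exceeds \<open>e\<^sub>1\<close> and cannot be blocked.\<close>
    have "0 < i \<and> e\<^sub>2 < i + k \<and> e\<^sub>3 < i + l \<or> 0 < j \<and> e\<^sub>4 < j + k \<and> e\<^sub>5 < j + l"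
      using 2 adm e24 e35 e23 e45 by linarith
    then have "0 < i \<and> admissible (i - 1) j k l \<or> 0 < j \<and> admissible i (j - 1) k l"
      using 2 adm unfolding admissible_def by auto
    then show ?thesis
      by (elim disjE conjE) (rule step, assumption, simp_all, rule step, assumption, simp_all)
  next
    case 3
    have "0 < k \<and> e\<^sub>2 < i + k \<and> e\<^sub>4 < j + k \<or> 0 < l \<and> e\<^sub>3 < i + l \<and> e\<^sub>5 < j + l"
      using 3 adm e24 e35 e23 e45 by linarith
    then have "0 < k \<and> admissible i j (k - 1) l \<or> 0 < l \<and> admissible i j k (l - 1)"
      using 3 adm unfolding admissible_def by auto
    then show ?thesis
      by (elim disjE conjE) (rule step, assumption, simp_all, rule step, assumption, simp_all)
  qed
qed

text \<open>As \<open>k + l = e\<^sub>6\<close> exceeds \<open>e\<^sub>2 + e\<^sub>3\<close> and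
  \<open>e\<^sub>4 + e\<^sub>5\<close>, at most one truncated difference on each side is positive,
  so bounding their sum amounts to bounding each of them.\<close>

lemma rows_iff_admissible:
  assumes "i + j = e\<^sub>1" "k + l = e\<^sub>6"
  shows "(i, k) \<in> rows e\<^sub>6 \<longleftrightarrow> admissible i j k l"
proof -
  have e: "e\<^sub>6 - k = l" "k \<le> e\<^sub>6" using assms by auto
  have "(e\<^sub>2 - k) + (e\<^sub>3 - l) \<le> i \<longleftrightarrow> e\<^sub>2 \<le> i + k \<and> e\<^sub>3 \<le> i + l"
    using e23 assms by auto
  moreover have "i \<le> e\<^sub>1 - (e\<^sub>4 - k) - (e\<^sub>5 - l) \<longleftrightarrow> (e\<^sub>4 - k) + (e\<^sub>5 - l) \<le> j"
    using e24 e35 e45 assms by auto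
  moreover have "(e\<^sub>4 - k) + (e\<^sub>5 - l) \<le> j \<longleftrightarrow> e\<^sub>4 \<le> j + k \<and> e\<^sub>5 \<le> j + l"
    using e45 assms by auto
  ultimately show ?thesis
    using assms e by (simp add: rows_def lo_def hi_def admissible_def)
qed

text \<open>By descent every admissible monomial is a multiple of one in the region; conversely,
  multiples of admissible monomials are admissible.\<close>

lemma point_ideal_rows:
  "point_ideal (rows e\<^sub>6) =
    {p. \<forall>m\<in>keys p. admissible (lookup m w) (lookup m x) (lookup m y) (lookup m z)}"
proof -
  have "(\<exists>s\<in>point_monomial ` rows e\<^sub>6. \<exists>t. m = s + t) \<longleftrightarrow>
      admissible (lookup m w) (lookup m x) (lookup m y) (lookup m z)" (is "?L \<longleftrightarrow> ?R") for m
  proof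
    assume ?L
    then obtain i k where ik: "(i, k) \<in> rows e\<^sub>6" "\<exists>t. m = point_monomial (i, k) + t" by auto
    then have "i \<le> lookup m w" "e\<^sub>1 - i \<le> lookup m x" "k \<le> lookup m y" "e\<^sub>6 - k \<le> lookup m z"
      unfolding exponent_dvd_iff all_vars lookup_point_monomial by auto
    moreover have "admissible i (e\<^sub>1 - i) k (e\<^sub>6 - k)"
      using ik(1) rows_box[of e\<^sub>6] rows_iff_admissible[of i "e\<^sub>1 - i" k "e\<^sub>6 - k"] by auto
    ultimately show ?R unfolding admissible_def by linarith
  next
    assume ?R
    from admissible_descent[OF this] obtain i j k l where
      le: "i \<le> lookup m w" "j \<le> lookup m x" "k \<le> lookup m y" "l \<le> lookup m z"
      and adm: "admissible i j k l" "i + j = e\<^sub>1" "k + l = e\<^sub>6" by blast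
    have "\<exists>t. m = point_monomial (i, k) + t"
      unfolding exponent_dvd_iff all_vars lookup_point_monomial using le adm(2,3) by auto
    moreover have "(i, k) \<in> rows e\<^sub>6" using rows_iff_admissible[OF adm(2,3)] adm(1) by simp
    ultimately show ?L by blast
  qed
  then show ?thesis by (simp add: point_ideal_def monomial_ideal_def)
qed

section \<open>Counting points, edges and squares\<close>

lemma row_length: "k \<le> e\<^sub>6 \<Longrightarrow> real (hi k - lo k) =
    real e\<^sub>1 - real (e\<^sub>2 - k) - real (e\<^sub>3 - (e\<^sub>6 - k)) - real (e\<^sub>4 - k) - real (e\<^sub>5 - (e\<^sub>6 - k))"
proof -
  assume k: "k \<le> e\<^sub>6"
  have "(e\<^sub>4 - k) + (e\<^sub>5 - (e\<^sub>6 - k)) \<le> e\<^sub>1" using e24 e35 e45 k by auto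
  then have "real (hi k) = real e\<^sub>1 - real (e\<^sub>4 - k) - real (e\<^sub>5 - (e\<^sub>6 - k))"
    by (simp add: hi_def of_nat_diff)
  then show ?thesis using lo_le_hi[OF k] by (simp add: of_nat_diff lo_def)
qed

lemma overlap_length: "k < e\<^sub>6 \<Longrightarrow> real (overlap_hi k - overlap_lo k) =
    real e\<^sub>1 - real (e\<^sub>2 - k) - real (e\<^sub>3 - (e\<^sub>6 - Suc k)) - real (e\<^sub>4 - k) - real (e\<^sub>5 - (e\<^sub>6 - Suc k))"
proof -
  assume k: "k < e\<^sub>6"
  have "(e\<^sub>4 - k) + (e\<^sub>5 - (e\<^sub>6 - Suc k)) \<le> e\<^sub>1" using e24 e35 e45 k by auto
  then have "real (overlap_hi k) = real e\<^sub>1 - real (e\<^sub>4 - k) - real (e\<^sub>5 - (e\<^sub>6 - Suc k))"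
    by (simp add: overlap_hi_def of_nat_diff)
  then show ?thesis using overlap_lo_le_hi[OF k] by (simp add: of_nat_diff overlap_lo_def)
qed

text \<open>This is the number of lattice points in the four removed triangles.\<close>

definition corners :: real where
  "corners = real e\<^sub>2 * (real e\<^sub>2 + 1) / 2 + real e\<^sub>3 * (real e\<^sub>3 + 1) / 2 +
    real e\<^sub>4 * (real e\<^sub>4 + 1) / 2 + real e\<^sub>5 * (real e\<^sub>5 + 1) / 2"

lemma sum_row_length: "(\<Sum>k\<le>e\<^sub>6. real (hi k - lo k)) = (real e\<^sub>6 + 1) * real e\<^sub>1 - corners"
proof -
  have le: "e\<^sub>2 \<le> e\<^sub>6" "e\<^sub>3 \<le> e\<^sub>6" "e\<^sub>4 \<le> e\<^sub>6" "e\<^sub>5 \<le> e\<^sub>6" using e23 e45 by auto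
  have "(\<Sum>k\<le>e\<^sub>6. real (hi k - lo k)) = (\<Sum>k\<le>e\<^sub>6. real e\<^sub>1 - real (e\<^sub>2 - k) -
      real (e\<^sub>3 - (e\<^sub>6 - k)) - real (e\<^sub>4 - k) - real (e\<^sub>5 - (e\<^sub>6 - k)))"
    by (intro sum.cong refl row_length) simp
  also have "\<dots> = (real e\<^sub>6 + 1) * real e\<^sub>1 - corners"
    unfolding sum_subtractf sum_triangle_atMost[OF le(1)] sum_triangle_atMost[OF le(2)]
      sum_triangle_atMost[OF le(3)] sum_triangle_atMost[OF le(4)] corners_def by simp
  finally show ?thesis .
qed

lemma sum_overlap_length: "(\<Sum>k<e\<^sub>6. real (overlap_hi k - overlap_lo k)) = real e\<^sub>6 * real e\<^sub>1 - corners"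
proof -
  have le: "e\<^sub>2 \<le> e\<^sub>6" "e\<^sub>3 \<le> e\<^sub>6" "e\<^sub>4 \<le> e\<^sub>6" "e\<^sub>5 \<le> e\<^sub>6" using e23 e45 by auto
  have "(\<Sum>k<e\<^sub>6. real (overlap_hi k - overlap_lo k)) = (\<Sum>k<e\<^sub>6. real e\<^sub>1 - real (e\<^sub>2 - k) -
      real (e\<^sub>3 - (e\<^sub>6 - Suc k)) - real (e\<^sub>4 - k) - real (e\<^sub>5 - (e\<^sub>6 - Suc k)))"
    by (intro sum.cong refl overlap_length) simp
  also have "\<dots> = real e\<^sub>6 * real e\<^sub>1 - corners"
    unfolding sum_subtractf sum_triangle[OF le(1)] sum_triangle_rev[OF le(2)]
      sum_triangle[OF le(3)] sum_triangle_rev[OF le(4)] corners_def by simp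
  finally show ?thesis .
qed

theorem linear_resolution_admissible:
  obtains b\<^sub>1 b\<^sub>2 b\<^sub>3 where
    "linear_resolution (int (e\<^sub>1 + e\<^sub>6)) {p :: ('v, 'k::comm_ring_1) polynomial.
      \<forall>m\<in>keys p. admissible (lookup m w) (lookup m x) (lookup m y) (lookup m z)} b\<^sub>1 b\<^sub>2 b\<^sub>3"
    "real b\<^sub>1 = (real e\<^sub>1 + 1) * (real e\<^sub>6 + 1) - corners"
    "real b\<^sub>2 = 2 * real e\<^sub>1 * real e\<^sub>6 + real e\<^sub>1 + real e\<^sub>6 - 2 * corners"
    "real b\<^sub>3 = real e\<^sub>1 * real e\<^sub>6 - corners"
proof
  show "linear_resolution (int (e\<^sub>1 + e\<^sub>6)) {p :: ('v, 'k::comm_ring_1) polynomial.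
      \<forall>m\<in>keys p. admissible (lookup m w) (lookup m x) (lookup m y) (lookup m z)}
    (\<Sum>k\<le>e\<^sub>6. hi k - lo k + 1) ((\<Sum>k\<le>e\<^sub>6. hi k - lo k) + (\<Sum>k<e\<^sub>6. overlap_hi k - overlap_lo k + 1))
    (\<Sum>k<e\<^sub>6. overlap_hi k - overlap_lo k)"
    using linear_resolution_rows[of e\<^sub>6] unfolding point_ideal_rows by simp
  have n: "(\<Sum>k\<le>e\<^sub>6. real 1) = real e\<^sub>6 + 1" "(\<Sum>k<e\<^sub>6. real 1) = real e\<^sub>6" by simp_all
  show "real (\<Sum>k\<le>e\<^sub>6. hi k - lo k + 1) = (real e\<^sub>1 + 1) * (real e\<^sub>6 + 1) - corners"
    unfolding of_nat_sum of_nat_add sum.distrib sum_row_length n by (simp add: algebra_simps)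
  show "real ((\<Sum>k\<le>e\<^sub>6. hi k - lo k) + (\<Sum>k<e\<^sub>6. overlap_hi k - overlap_lo k + 1)) =
      2 * real e\<^sub>1 * real e\<^sub>6 + real e\<^sub>1 + real e\<^sub>6 - 2 * corners"
  proof -
    have "real ((\<Sum>k\<le>e\<^sub>6. hi k - lo k) + (\<Sum>k<e\<^sub>6. overlap_hi k - overlap_lo k + 1)) =
        ((real e\<^sub>6 + 1) * real e\<^sub>1 - corners) + ((real e\<^sub>6 * real e\<^sub>1 - corners) + real e\<^sub>6)"
      unfolding of_nat_sum of_nat_add sum.distrib sum_row_length sum_overlap_length n ..
    also have "\<dots> = 2 * (real e\<^sub>1 * real e\<^sub>6) + real e\<^sub>1 + real e\<^sub>6 - 2 * corners"
      by (simp only: distrib_right mult_1_left mult.commute[of "real e\<^sub>6" "real e\<^sub>1"])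
    finally show ?thesis by (simp only: mult.assoc)
  qed
  show "real (\<Sum>k<e\<^sub>6. overlap_hi k - overlap_lo k) = real e\<^sub>1 * real e\<^sub>6 - corners"
    unfolding of_nat_sum sum_overlap_length by (simp only: mult.commute)
qed

end

section \<open>The ideals of the curves and their resolutions\<close>

lemma ideal_gen_base: "p \<in> S \<Longrightarrow> p \<in> ideal_gen S"
  unfolding ideal_gen_def by (rule ring_as_module.span_base)

lemma ideal_gen_add: "p \<in> ideal_gen S \<Longrightarrow> q \<in> ideal_gen S \<Longrightarrow> p + q \<in> ideal_gen S"
  unfolding ideal_gen_def by (rule ring_as_module.span_add)

lemma ideal_gen_minimal: "S \<subseteq> T \<Longrightarrow> ring_as_module.subspace T \<Longrightarrow> ideal_gen S \<subseteq> T"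
  unfolding ideal_gen_def by (rule ring_as_module.span_minimal)

section \<open>Powers of edge ideals as conditions on exponents\<close>

definition edge_order_ideal :: "'v \<Rightarrow> 'v \<Rightarrow> nat \<Rightarrow> ('v, 'k::comm_ring_1) polynomial set" where
  "edge_order_ideal x y n = {p. \<forall>m\<in>keys p. n \<le> lookup m x + lookup m y}"

lemma subspace_edge_order_ideal: "ring_as_module.subspace (edge_order_ideal x y n)"
proof (rule ring_as_module.subspaceI)
  fix p q :: "('a, 'b) polynomial"
  assume pq: "p \<in> edge_order_ideal x y n" "q \<in> edge_order_ideal x y n"
  then show "p + q \<in> edge_order_ideal x y n"
    using keys_add[of p q] by (auto simp: edge_order_ideal_def)
next
  fix c p :: "('a, 'b) polynomial"
  assume "p \<in> edge_order_ideal x y n"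
  then show "c * p \<in> edge_order_ideal x y n"
    using keys_mult[of c p] by (force simp: edge_order_ideal_def lookup_add)
qed (simp add: edge_order_ideal_def)

text \<open>For the inclusion from left to right, orders along the edge add under multiplication.
  For the other, terms of \<open>p\<close> containing \<open>x\<close> give up one factor
  \<open>x\<close> and the remaining ones a factor \<open>y\<close>, and each loses exactly one in
  order.\<close>

lemma ideal_mult_edge_ideal:
  assumes "x \<noteq> y"
  shows "ideal_mult (ideal_gen {Var x, Var y}) (edge_order_ideal x y n) =
    (edge_order_ideal x y (Suc n) :: ('v, 'k::comm_ring_1) polynomial set)"
proof
  have "{Var x, Var y} \<subseteq> (edge_order_ideal x y 1 :: ('v, 'k) polynomial set)"
    by (auto simp: edge_order_ideal_def Var_def)
  then have edge: "ideal_gen {Var x, Var y} \<subseteq> (edge_order_ideal x y 1 :: ('v, 'k) polynomial set)"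
    by (rule ideal_gen_minimal[OF _ subspace_edge_order_ideal])
  have "p * q \<in> edge_order_ideal x y (Suc n)"
    if "p \<in> edge_order_ideal x y 1" "q \<in> edge_order_ideal x y n" for p q :: "('v, 'k) polynomial"
    using that keys_mult[of p q] by (fastforce simp: edge_order_ideal_def lookup_add)
  then have "{p * q | p q. p \<in> ideal_gen {Var x, Var y} \<and> q \<in> edge_order_ideal x y n} \<subseteq>
      (edge_order_ideal x y (Suc n) :: ('v, 'k) polynomial set)"
    using edge by blast
  then show "ideal_mult (ideal_gen {Var x, Var y}) (edge_order_ideal x y n) \<subseteq>
      (edge_order_ideal x y (Suc n) :: ('v, 'k) polynomial set)"
    unfolding ideal_mult_def by (rule ideal_gen_minimal[OF _ subspace_edge_order_ideal])
next
  show "(edge_order_ideal x y (Suc n) :: ('v, 'k) polynomial set) \<subseteq>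
      ideal_mult (ideal_gen {Var x, Var y}) (edge_order_ideal x y n)"
  proof
    fix p :: "('v, 'k) polynomial" assume p: "p \<in> edge_order_ideal x y (Suc n)"
    let ?X = "\<lambda>m. 0 < lookup m x"
    have "\<And>m. m \<in> keys (part ?X p) \<Longrightarrow> 0 < lookup m x" by (simp add: keys_part)
    then obtain q where q: "part ?X p = Var x * q" by (rule Var_dvd) blast
    have "\<And>m. m \<in> keys (part (\<lambda>m. \<not> ?X m) p) \<Longrightarrow> 0 < lookup m y"
      using p by (fastforce simp: edge_order_ideal_def keys_part)
    then obtain r where r: "part (\<lambda>m. \<not> ?X m) p = Var y * r" by (rule Var_dvd) blast
    have order: "n \<le> lookup m x + lookup m y"
      if "v = x \<or> v = y" "m \<in> keys s" "keys (Var v * s) \<subseteq> keys p" for v m and s :: "('v, 'k) polynomial"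
    proof -
      have "single v 1 + m \<in> keys p" using that(2,3) unfolding keys_Var_mult by blast
      then have "Suc n \<le> lookup (single v 1 + m) x + lookup (single v 1 + m) y"
        using p by (auto simp: edge_order_ideal_def)
      then show ?thesis using that(1) assms by (auto simp: lookup_add)
    qed
    have "keys (Var x * q) \<subseteq> keys p" "keys (Var y * r) \<subseteq> keys p"
      unfolding q[symmetric] r[symmetric] by (auto simp: keys_part)
    then have qr: "q \<in> edge_order_ideal x y n" "r \<in> edge_order_ideal x y n"
      unfolding edge_order_ideal_def using order by blast+
    have gen: "Var x \<in> ideal_gen {Var x, Var y}" "Var y \<in> ideal_gen {Var x, Var y}"
      by (rule ideal_gen_base, simp)+
    have "Var x * q \<in> ideal_mult (ideal_gen {Var x, Var y}) (edge_order_ideal x y n)"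
      "Var y * r \<in> ideal_mult (ideal_gen {Var x, Var y}) (edge_order_ideal x y n)"
      unfolding ideal_mult_def by (rule ideal_gen_base; use gen qr in blast)+
    then have "Var x * q + Var y * r \<in> ideal_mult (ideal_gen {Var x, Var y}) (edge_order_ideal x y n)"
      unfolding ideal_mult_def by (rule ideal_gen_add)
    then show "p \<in> ideal_mult (ideal_gen {Var x, Var y}) (edge_order_ideal x y n)"
      unfolding q[symmetric] r[symmetric] part_split .
  qed
qed

lemma ideal_power_edge_ideal:
  assumes "x \<noteq> y"
  shows "ideal_power (edge_ideal x y :: (var, 'k::field) polynomial set) n = edge_order_ideal x y n"
proof (induction n)
  case 0
  show ?case by (simp add: edge_order_ideal_def)
next
  case (Suc n)
  show ?case
    unfolding ideal_power.simps Suc.IH unfolding edge_ideal_def by (rule ideal_mult_edge_ideal[OF assms])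
qed

lemma tetrahedral_ideal_eq:
  "(tetrahedral_ideal a :: (var, 'k::field) polynomial set) = {p. \<forall>m\<in>keys p.
    a 1 \<le> lookup m Xa + lookup m Xb \<and> a 2 \<le> lookup m Xa + lookup m Xc \<and>
    a 3 \<le> lookup m Xa + lookup m Xd \<and> a 4 \<le> lookup m Xb + lookup m Xc \<and>
    a 5 \<le> lookup m Xb + lookup m Xd \<and> a 6 \<le> lookup m Xc + lookup m Xd}"
  unfolding tetrahedral_ideal_def by (subst ideal_power_edge_ideal, simp)+ (auto simp: edge_order_ideal_def)

section \<open>From linear resolutions to minimal graded free resolutions\<close>

lemma sum_monomials:
  "p = (\<Sum>m\<in>keys p. single m (lookup p m :: 'k::comm_monoid_add))"
  by (intro poly_mapping_eqI)
    (simp add: lookup_sum lookup_single when_def sum.delta' in_keys_iff cong: if_cong)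

lemma homogeneous_in_irrelevant_ideal:
  fixes p :: "('v, 'k::comm_ring_1) polynomial"
  assumes "homogeneous p e" "e \<noteq> 0"
  shows "p \<in> irrelevant_ideal"
proof -
  have "single m (lookup p m) \<in> irrelevant_ideal" if "m \<in> keys p" for m
  proof -
    have "monom_degree m \<noteq> 0" using assms that by (auto simp: homogeneous_def)
    then obtain v where "lookup m v \<noteq> 0"
      unfolding monom_degree_def by (meson sum.neutral)
    then have "m = (m - single v 1) + single v 1"
      by (intro poly_mapping_eqI) (auto simp: lookup_add lookup_minus)
    then have "single m (lookup p m) = single (m - single v 1) (lookup p m) * Var v"
      unfolding Var_def mult_single by simp
    then show ?thesis
      unfolding irrelevant_ideal_def ideal_gen_def
      by (simp only:) (intro ring_as_module.span_scale ring_as_module.span_base rangeI)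
  qed
  then have "(\<Sum>m\<in>keys p. single m (lookup p m)) \<in> irrelevant_ideal"
    unfolding irrelevant_ideal_def ideal_gen_def by (rule ring_as_module.span_sum)
  then show ?thesis using sum_monomials[of p] by simp
qed

lemma elements_mat_in_irrelevant_ideal:
  assumes "homogeneous_mat 1 A"
  shows "elements_mat A \<subseteq> irrelevant_ideal"
proof
  fix p assume "p \<in> elements_mat A"
  then obtain i j where "i < dim_row A" "j < dim_col A" "p = A $$ (i, j)" by blast
  then have "homogeneous p 1" using assms by (simp add: homogeneous_mat_def)
  then show "p \<in> irrelevant_ideal" by (rule homogeneous_in_irrelevant_ideal) simp
qed

lemma graded_hom_replicate:
  assumes "A \<in> carrier_mat n m" "homogeneous_mat (e - f) A"
  shows "graded_hom (replicate m e) (replicate n f) A"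
  using assms by (auto simp: graded_hom_def homogeneous_mat_def)

lemma minimal_resolution_of_linear_resolution:
  fixes I :: "('v, 'k::comm_ring_1) polynomial set"
  assumes "linear_resolution d I b\<^sub>1 b\<^sub>2 b\<^sub>3"
  defines "Fs \<equiv> [replicate b\<^sub>1 d, replicate b\<^sub>2 (d + 1), replicate b\<^sub>3 (d + 2)]"
  obtains \<phi> where "minimal_graded_free_resolution I (\<lambda>i. if i < length Fs then Fs ! i else []) \<phi>"
proof -
  from assms(1) obtain A B C where A: "A \<in> carrier_mat 1 b\<^sub>1" "homogeneous_mat d A"
    and B: "B \<in> carrier_mat b\<^sub>1 b\<^sub>2" "homogeneous_mat 1 B"
    and C: "C \<in> carrier_mat b\<^sub>2 b\<^sub>3" "homogeneous_mat 1 C"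
    and exact: "(\<lambda>v. v $ 0) ` image_mat A = I" "image_mat B = kernel_mat A"
      "image_mat C = kernel_mat B" "kernel_mat C = {0\<^sub>v b\<^sub>3}"
    unfolding linear_resolution_def by blast
  define F where "F = (\<lambda>i. if i < length Fs then Fs ! i else [])"
  \<comment> \<open>Past \<open>C\<close> the differentials have no columns. The image of
    \<open>\<phi> 3\<close> is zero, so exactness at \<open>F 2\<close> is the injectivity of
    \<open>C\<close>; from there on all modules vanish.\<close>
  define \<phi> where "\<phi> i = (if i = 0 then A else if i = 1 then B else if i = 2 then C
    else 0\<^sub>m (length (F (i - 1))) 0)" for i
  have F: "F 0 = replicate b\<^sub>1 d" "F 1 = replicate b\<^sub>2 (d + 1)" "F 2 = replicate b\<^sub>3 (d + 2)"
    "\<And>i. F (Suc (Suc (Suc i))) = []"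
    by (simp_all add: F_def Fs_def)
  have \<phi>: "\<phi> 0 = A" "\<phi> 1 = B" "\<phi> 2 = C" "\<phi> 3 = 0\<^sub>m b\<^sub>3 0" "\<And>i. \<phi> (Suc (Suc (Suc (Suc i)))) = 0\<^sub>m 0 0"
    using F by (simp_all add: \<phi>_def)
  have nat_cases: "Q i" if "Q 0" "Q 1" "Q 2" "\<And>i. Q (Suc (Suc (Suc i)))" for Q and i :: nat
    using that by (metis One_nat_def Suc_1 not0_implies_Suc)
  have "graded_hom (F 0) [0] (\<phi> 0)"
    using graded_hom_replicate[of A 1 b\<^sub>1 d 0] A by (simp add: F \<phi>)
  moreover have "graded_hom (F (Suc i)) (F i) (\<phi> (Suc i))" for i
  proof (rule nat_cases[of _ i])
    show "graded_hom (F (Suc 0)) (F 0) (\<phi> (Suc 0))"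
      using graded_hom_replicate[of B b\<^sub>1 b\<^sub>2 "d + 1" d] B F \<phi> by simp
    show "graded_hom (F (Suc 1)) (F 1) (\<phi> (Suc 1))"
      using graded_hom_replicate[of C b\<^sub>2 b\<^sub>3 "d + 2" "d + 1"] C F \<phi> by (simp add: numeral_2_eq_2)
    show "graded_hom (F (Suc 2)) (F 2) (\<phi> (Suc 2))"
      using F \<phi> by (simp add: graded_hom_def numeral_2_eq_2 numeral_3_eq_3)
    show "graded_hom (F (Suc (Suc (Suc (Suc i))))) (F (Suc (Suc (Suc i)))) (\<phi> (Suc (Suc (Suc (Suc i)))))" for i
      using F \<phi> by (simp add: graded_hom_def)
  qed
  moreover have "image_mat (\<phi> (Suc i)) = kernel_mat (\<phi> i)" for i
  proof (rule nat_cases[of _ i])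
    have "image_mat (0\<^sub>m b\<^sub>3 0) = {0\<^sub>v b\<^sub>3 :: ('v, 'k) polynomial vec}"
      by (rule image_mat_no_cols) simp
    then show "image_mat (\<phi> (Suc 2)) = kernel_mat (\<phi> 2)"
      using exact(4) \<phi> by (simp add: numeral_2_eq_2 numeral_3_eq_3)
    have no_cols: "image_mat (0\<^sub>m 0 0) = {0\<^sub>v 0 :: ('v, 'k) polynomial vec}"
      "kernel_mat (0\<^sub>m n 0) = {0\<^sub>v 0 :: ('v, 'k) polynomial vec}" for n
      by (rule image_mat_no_cols[OF zero_carrier_mat], rule kernel_mat_no_cols[OF zero_carrier_mat])
    then show "image_mat (\<phi> (Suc (Suc (Suc (Suc i))))) = kernel_mat (\<phi> (Suc (Suc (Suc i))))" for i
      unfolding \<phi>(5) by (cases i) (simp_all add: \<phi>_def)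
  qed (use exact \<phi> in \<open>simp_all add: numeral_2_eq_2\<close>)
  moreover have "elements_mat (\<phi> (Suc i)) \<subseteq> irrelevant_ideal" for i
  proof (rule elements_mat_in_irrelevant_ideal, rule nat_cases[of _ i])
    show "homogeneous_mat 1 (\<phi> (Suc (Suc (Suc (Suc i)))))" for i
      unfolding \<phi>(5) by (rule homogeneous_mat_zero)
  qed (use B C \<phi> homogeneous_mat_zero in \<open>simp_all add: numeral_2_eq_2 numeral_3_eq_3\<close>)
  ultimately have "minimal_graded_free_resolution I F \<phi>"
    unfolding minimal_graded_free_resolution_def graded_free_resolution_def
    using exact(1) \<phi>(1) by blast
  then show thesis using that unfolding F_def by blast
qed

lemma has_linear_minimal_free_resolutionI:
  assumes "linear_resolution d I b\<^sub>1 b\<^sub>2 b\<^sub>3"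
  shows "has_linear_minimal_free_resolution I"
proof -
  let ?Fs = "[replicate b\<^sub>1 d, replicate b\<^sub>2 (d + 1), replicate b\<^sub>3 (d + 2)]"
  let ?F = "\<lambda>i. if i < length ?Fs then ?Fs ! i else []"
  obtain \<phi> where "minimal_graded_free_resolution I ?F \<phi>"
    by (rule minimal_resolution_of_linear_resolution[OF assms])
  moreover have "\<forall>e\<in>set (?F i). e = d + int i" for i
  proof -
    consider "i = 0" | "i = 1" | "i = 2" | "2 < i" by linarith
    then show ?thesis by cases auto
  qed
  ultimately show ?thesis unfolding has_linear_minimal_free_resolution_def by blast
qed

section \<open>S-minimality and the dominating pair of opposite edges\<close>

lemma vars_UNIV_set: "UNIV = {Xa, Xb, Xc, Xd}"
  by (auto intro: var.exhaust)

text \<open>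
  One edge of the dominating pair has maximal weight. This rules out all but one of the three ways
  in which each system can fail.
\<close>

lemma opposite_edges_dominate:
  assumes "S_minimal a"
  obtains "a 2 + a 4 < a 1" "a 3 + a 5 < a 1" "a 2 + a 3 < a 6" "a 4 + a 5 < a 6"
  | "a 1 + a 4 < a 2" "a 3 + a 6 < a 2" "a 1 + a 3 < a 5" "a 4 + a 6 < a 5"
  | "a 1 + a 5 < a 3" "a 2 + a 6 < a 3" "a 1 + a 2 < a 4" "a 5 + a 6 < a 4"
proof -
  have A: "\<not> system_A a" and B: "\<not> system_B a" and C: "\<not> system_C a" and D: "\<not> system_D a"
    using assms by (auto simp: S_minimal_def)
  note sys = A[unfolded system_A_def] B[unfolded system_B_def]
    C[unfolded system_C_def] D[unfolded system_D_def]
  define M where "M n \<longleftrightarrow> a 1 \<le> n \<and> a 2 \<le> n \<and> a 3 \<le> n \<and> a 4 \<le> n \<and> a 5 \<le> n \<and> a 6 \<le> n" for n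
  let ?A = "{a 1, a 2, a 3, a 4, a 5, a 6}"
  have M: "M (Max ?A)" unfolding M_def by (intro conjI Max_ge) simp_all
  have "Max ?A \<in> ?A" by (rule Max_in) simp_all
  then have "M (a 1) \<or> M (a 2) \<or> M (a 3) \<or> M (a 4) \<or> M (a 5) \<or> M (a 6)"
    using M by (elim insertE emptyE) (simp_all only: simp_thms)
  then consider "M (a 1) \<or> M (a 6)" | "M (a 2) \<or> M (a 5)" | "M (a 3) \<or> M (a 4)"
    by blast
  then show thesis
  proof cases
    case 1
    \<comment> \<open>The four bounds arise in two rounds. If \<open>a 6\<close> is maximal, (C) and
      (D) fail at their first inequality; this makes \<open>a 1\<close> exceed \<open>a 4\<close>
      and \<open>a 5\<close>, so (A) and (B) must fail at \<open>a 6\<close>. If \<open>a 1\<close>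
      is maximal, the rounds are interchanged.\<close>
    have "a 2 + a 4 < a 1" "a 3 + a 5 < a 1" "a 2 + a 3 < a 6" "a 4 + a 5 < a 6"
      using 1[unfolded M_def] sys by linarith+
    then show thesis by (rule that(1))
  next
    case 2
    have "a 1 + a 4 < a 2" "a 3 + a 6 < a 2" "a 1 + a 3 < a 5" "a 4 + a 6 < a 5"
      using 2[unfolded M_def] sys by linarith+
    then show thesis by (rule that(2))
  next
    case 3
    have "a 1 + a 5 < a 3" "a 2 + a 6 < a 3" "a 1 + a 2 < a 4" "a 5 + a 6 < a 4"
      using 3[unfolded M_def] sys by linarith+
    then show thesis by (rule that(3))
  qed
qed

theorem theorem4p2:
  fixes a :: "nat \<Rightarrow> nat"
  assumes "nontrivial_curve a" and "S_minimal a"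
  shows "has_linear_minimal_free_resolution (tetrahedral_ideal a :: (var, 'k::field) polynomial set) \<and>
    (a 6 = Max (a ` {1..6}) \<and> a 6 > 0 \<longrightarrow>
      (\<exists>\<beta>\<^sub>1 \<beta>\<^sub>2 \<beta>\<^sub>3 :: nat.
         has_minimal_free_resolution_of_form (tetrahedral_ideal a :: (var, 'k) polynomial set)
           [replicate \<beta>\<^sub>1 (int (a 1 + a 6)),
            replicate \<beta>\<^sub>2 (int (a 1 + a 6 + 1)),
            replicate \<beta>\<^sub>3 (int (a 1 + a 6 + 2))] \<and>
         real \<beta>\<^sub>1 = (real (a 1) + 1) * (real (a 6) + 1) - (\<Sum>i=2..5. real (a i) * (real (a i) + 1) / 2) \<and>
         real \<beta>\<^sub>2 = 2 * real (a 1) * real (a 6) + real (a 1) + real (a 6)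
                    - (\<Sum>i=2..5. real (a i) * (real (a i) + 1)) \<and>
         real \<beta>\<^sub>3 = real (a 1) * real (a 6) - (\<Sum>i=2..5. real (a i) * (real (a i) + 1) / 2)))"
    (is "?linear \<and> (?max \<longrightarrow> ?form)")
proof
  show ?linear
    using opposite_edges_dominate[OF assms(2)]
  proof cases
    case 1
    then interpret tetrahedron Xa Xb Xc Xd "a 1" "a 2" "a 3" "a 4" "a 5" "a 6"
      by unfold_locales (auto simp: vars_UNIV_set)
    have eq: "tetrahedral_ideal a = {p :: (var, 'k) polynomial. \<forall>m\<in>keys p.
        admissible (lookup m Xa) (lookup m Xb) (lookup m Xc) (lookup m Xd)}"
      unfolding tetrahedral_ideal_eq admissible_def by blast
    show ?thesis
      unfolding eq by (rule linear_resolution_admissible, rule has_linear_minimal_free_resolutionI)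
  next
    case 2
    \<comment> \<open>Exchanging the vertices \<open>Xb\<close> and \<open>Xc\<close> permutes the
      weights and puts the dominating edges \<open>Xa Xc\<close> and \<open>Xb Xd\<close> in
      place.\<close>
    then interpret tetrahedron Xa Xc Xb Xd "a 2" "a 1" "a 3" "a 4" "a 6" "a 5"
      by unfold_locales (auto simp: vars_UNIV_set)
    have eq: "tetrahedral_ideal a = {p :: (var, 'k) polynomial. \<forall>m\<in>keys p.
        admissible (lookup m Xa) (lookup m Xc) (lookup m Xb) (lookup m Xd)}"
      unfolding tetrahedral_ideal_eq admissible_def by (auto simp: add.commute)
    show ?thesis
      unfolding eq by (rule linear_resolution_admissible, rule has_linear_minimal_free_resolutionI)
  next
    case 3
    then interpret tetrahedron Xa Xd Xb Xc "a 3" "a 1" "a 2" "a 5" "a 6" "a 4"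
      by unfold_locales (auto simp: vars_UNIV_set)
    have eq: "tetrahedral_ideal a = {p :: (var, 'k) polynomial. \<forall>m\<in>keys p.
        admissible (lookup m Xa) (lookup m Xd) (lookup m Xb) (lookup m Xc)}"
      unfolding tetrahedral_ideal_eq admissible_def by (auto simp: add.commute)
    show ?thesis
      unfolding eq by (rule linear_resolution_admissible, rule has_linear_minimal_free_resolutionI)
  qed
  show "?max \<longrightarrow> ?form"
  proof
    assume ?max
    then have max: "a i \<le> a 6" if "i \<in> {1..6}" for i
      using that by simp
    have "a 2 \<le> a 6" "a 3 \<le> a 6"
      by (rule max, simp)+
    \<comment> \<open>The other two dominating pairs would force \<open>a 2\<close> or
      \<open>a 3\<close> above \<open>a 6\<close>.\<close>
    then have "a 2 + a 4 < a 1 \<and> a 3 + a 5 < a 1 \<and> a 2 + a 3 < a 6 \<and> a 4 + a 5 < a 6"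
      by (cases rule: opposite_edges_dominate[OF assms(2)]) auto
    then interpret tetrahedron Xa Xb Xc Xd "a 1" "a 2" "a 3" "a 4" "a 5" "a 6"
      by unfold_locales (auto simp: vars_UNIV_set)
    have eq: "tetrahedral_ideal a = {p :: (var, 'k) polynomial. \<forall>m\<in>keys p.
        admissible (lookup m Xa) (lookup m Xb) (lookup m Xc) (lookup m Xd)}"
      unfolding tetrahedral_ideal_eq admissible_def by blast
    obtain b\<^sub>1 b\<^sub>2 b\<^sub>3 where res:
      "linear_resolution (int (a 1 + a 6)) (tetrahedral_ideal a :: (var, 'k) polynomial set) b\<^sub>1 b\<^sub>2 b\<^sub>3"
      and b: "real b\<^sub>1 = (real (a 1) + 1) * (real (a 6) + 1) - corners"
      "real b\<^sub>2 = 2 * real (a 1) * real (a 6) + real (a 1) + real (a 6) - 2 * corners"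
      "real b\<^sub>3 = real (a 1) * real (a 6) - corners"
      unfolding eq by (rule linear_resolution_admissible)
    have range: "{2..5} = {2, 3, 4, 5::nat}" by auto
    have sums: "corners = (\<Sum>i=2..5. real (a i) * (real (a i) + 1) / 2)"
      "2 * corners = (\<Sum>i=2..5. real (a i) * (real (a i) + 1))"
      by (simp_all add: range corners_def)
    obtain \<phi> where "minimal_graded_free_resolution (tetrahedral_ideal a :: (var, 'k) polynomial set)
      (\<lambda>i. if i < length [replicate b\<^sub>1 (int (a 1 + a 6)), replicate b\<^sub>2 (int (a 1 + a 6) + 1),
          replicate b\<^sub>3 (int (a 1 + a 6) + 2)]
        then [replicate b\<^sub>1 (int (a 1 + a 6)), replicate b\<^sub>2 (int (a 1 + a 6) + 1),
          replicate b\<^sub>3 (int (a 1 + a 6) + 2)] ! i else []) \<phi>"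
      by (rule minimal_resolution_of_linear_resolution[OF res])
    then have "has_minimal_free_resolution_of_form (tetrahedral_ideal a :: (var, 'k) polynomial set)
        [replicate b\<^sub>1 (int (a 1 + a 6)), replicate b\<^sub>2 (int (a 1 + a 6 + 1)),
          replicate b\<^sub>3 (int (a 1 + a 6 + 2))]"
      unfolding has_minimal_free_resolution_of_form_def of_nat_add[of "a 1 + a 6"] of_nat_1 of_nat_numeral
      by blast
    then show ?form
      using b unfolding sums(2) unfolding sums(1) by blast
  qed
qed

end
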